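(* Let $s$ be a weak composition and let $\operatorname{Perm}(s)$ be the $s$-permutahedron, i.e. the collection of all pure intervals (faces) of the $s$-weak order. Then $\operatorname{Perm}(s)$ is a combinatorial complex in the following sense. (1) The face of a face is also a face: if $I\in\operatorname{Perm}(s)$ is a face (a pure interval) and $J\subseteq I$ is a face (a pure interval), then $J\in \operatorname{Perm}(s)$. (2) The intersection of any two faces is also a face: if $I,J\in \operatorname{Perm}(s)$ are two faces (pure intervals) with $I\cap J\neq\emptyset$, then $I\cap J\in\operatorname{Perm}(s)$ is also a face (a pure interval).
   Context: A weak composition of length $n$ is a sequence $s=(s(1),\dots,s(n))$ of non-negative integers. An $s$-decreasing tree is a rooted planar tree with $n$ internal nodes labeled bijectively by $1,\dots,n$ (leaves are unlabeled) such that node $i$ has exactly $s(i)+1$ ordered children and labels decrease from root to leaves. For a node $y$ of such a tree $T$ with $s(y)=m$, let $T^y_0,\dots,T^y_m$ be the children of $y$ from left to right, where "child" means the whole subtree; a child is empty if it is just a leaf. $T^y_0$ is the left child, $T^y_m$ the right child (called a strict right child if $m>0$), and $T^y_i$ with $0<i<m$ are the middle children. A descendant of $y$ is a node lying in one of the $T^y_i$. Tree-inversions: for nodes $a<c$, $\#_T(c,a)$ is $0$ if $a$ is left of $c$ or belongs to $T^c_0$; it is $i$ if $a$ belongs to $T^c_i$ with $0<i<s(c)$; it is $s(c)$ if $a$ belongs to $T^c_{s(c)}$ or is right of $c$. $\operatorname{inv}(T)$ is the multi-set in which $(c,a)$ occurs $\#_T(c,a)$ times; it determines $T$. The $s$-weak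 order on $s$-decreasing trees is: $R\preccurlyeq T$ iff $\#_R(c,a)\le \#_T(c,a)$ for all $a<c$. It is known to be a lattice. Intervals are $[T_1,T_2]=\{R: T_1\preccurlyeq R\preccurlyeq T_2\}$ for $T_1\preccurlyeq T_2$. Transitive closure: for a multi-set $I$ of pairs $(c,a)$ with $1\le a<c\le n$, with multiplicities $\#_I(c,a)$, a transitivity path from $c$ to $a$ is a list $c=b_1>b_2>\dots>b_k=a$, $k\ge2$, with $\#_I(b_i,b_{i+1})>0$ for all $i$. The transitive closure $I^{\mathsf{tc}}$ has $\#_{I^{\mathsf{tc}}}(c,a)$ equal to the maximal value of $\#_I(b_1,b_2)$ over all transitivity paths from $c$ to $a$ (and $0$ if there is none). A pair $(a,c)$ with $a<c$ is a tree-ascent of $T$ if: (i) $a$ is a descendant of $c$; (ii) $a$ does not belong to the right child of $c$; (iii) whenever $c>b>a$ and $a$ is a descendant of $b$, $a$ belongs to the right child of $b$; (iv) if $s(a)>0$, the (strict) right child of $a$ is empty. For a (possibly empty) set $A$ of tree-ascents of $T$, $T+A$ is the $s$-decreasing tree whose multi-set of tree-inversions is obtained from $\operatorname{inv}(T)$ by increasing $\#_T(c,a)$ by one for every $(a,c)\in A$ and then taking the transitive closure (this is the tree-inversion multi-set of an $s$-decreasing tree). A pure interval is an interval of the form $[T,T+A]$. The $s$-permutahedron $\operatorname{Perm}(s)$ is the collection of all pure intervals; its elements are called faces, and one face is contained in another if the containment holds as intervals of the $s$-weak order. *)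

theory Defs
  imports "HOL-Library.Multiset"
begin

type_synonym weak_composition = "nat list"

text \<open>
  A weak composition \<open>s\<close> of length \<open>n\<close> is a list of length \<open>n\<close>; its parts are
  numbered from \<open>1\<close>, whereas list positions start at \<open>0\<close>.
\<close>

definition part :: "weak_composition \<Rightarrow> nat \<Rightarrow> nat" where
  "part s i = s ! (i - 1)"

datatype ptree = Leaf | Node nat "ptree list"

primrec labels :: "ptree \<Rightarrow> nat list" where
  "labels Leaf = []"
| "labels (Node y ts) = y # concat (map labels ts)"

primrec subtrees :: "ptree \<Rightarrow> ptree set" where
  "subtrees Leaf = {Leaf}"
| "subtrees (Node y ts) = insert (Node y ts) (\<Union> (set (map subtrees ts)))"

definition s_decreasing_tree :: "weak_composition \<Rightarrow> ptree \<Rightarrow> bool" where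
  "s_decreasing_tree s T \<longleftrightarrow>
     distinct (labels T) \<and> set (labels T) = {1..length s} \<and>
     (\<forall>y ts. Node y ts \<in> subtrees T \<longrightarrow>
        length ts = part s y + 1 \<and> (\<forall>t \<in> set ts. \<forall>a \<in> set (labels t). a < y))"

text \<open>Only meaningful if the labels of \<open>T\<close> are distinct and \<open>y\<close> is one of them.\<close>

definition children :: "ptree \<Rightarrow> nat \<Rightarrow> ptree list" where
  "children T y = (THE ts. Node y ts \<in> subtrees T)"

abbreviation child :: "ptree \<Rightarrow> nat \<Rightarrow> nat \<Rightarrow> ptree" where
  "child T y i \<equiv> children T y ! i"

abbreviation belongs :: "nat \<Rightarrow> ptree \<Rightarrow> bool" where
  "belongs a t \<equiv> a \<in> set (labels t)"

definition descendant :: "weak_composition \<Rightarrow> ptree \<Rightarrow> nat \<Rightarrow> nat \<Rightarrow> bool" where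
  "descendant s T a y \<longleftrightarrow> belongs y T \<and> (\<exists>i \<le> part s y. belongs a (child T y i))"

text \<open>\<open>a\<close> lies to the left of \<open>c\<close> when they branch off at different children of some node.\<close>

definition left_of :: "ptree \<Rightarrow> nat \<Rightarrow> nat \<Rightarrow> bool" where
  "left_of T a c \<longleftrightarrow>
     (\<exists>y ts i j. Node y ts \<in> subtrees T \<and> i < j \<and> j < length ts \<and>
        belongs a (ts ! i) \<and> belongs c (ts ! j))"

text \<open>
  For \<open>a < c\<close> in an \<open>s\<close>-decreasing tree, the last case below says that \<open>a\<close> belongs to the
  right child of \<open>c\<close> or is right of \<open>c\<close>.
\<close>

definition tree_inversion_number :: "weak_composition \<Rightarrow> ptree \<Rightarrow> nat \<Rightarrow> nat \<Rightarrow> nat" where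
  "tree_inversion_number s T c a =
     (if left_of T a c \<or> belongs a (child T c 0) then 0
      else if \<exists>i. 0 < i \<and> i < part s c \<and> belongs a (child T c i)
        then (THE i. 0 < i \<and> i < part s c \<and> belongs a (child T c i))
      else part s c)"

definition index_pairs :: "nat \<Rightarrow> (nat \<times> nat) set" where
  "index_pairs n = {(c, a). 1 \<le> a \<and> a < c \<and> c \<le> n}"

definition tree_inversions :: "weak_composition \<Rightarrow> ptree \<Rightarrow> (nat \<times> nat) multiset" where
  "tree_inversions s T =
     (\<Sum>(c, a) \<in> index_pairs (length s). replicate_mset (tree_inversion_number s T c a) (c, a))"

definition s_weak_le :: "weak_composition \<Rightarrow> ptree \<Rightarrow> ptree \<Rightarrow> bool" where
  "s_weak_le s R T \<longleftrightarrow>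
     (\<forall>(c, a) \<in> index_pairs (length s).
        tree_inversion_number s R c a \<le> tree_inversion_number s T c a)"

definition s_weak_interval :: "weak_composition \<Rightarrow> ptree \<Rightarrow> ptree \<Rightarrow> ptree set" where
  "s_weak_interval s T1 T2 =
     {R. s_decreasing_tree s R \<and> s_weak_le s T1 R \<and> s_weak_le s R T2}"

definition transitivity_path :: "(nat \<times> nat) multiset \<Rightarrow> nat \<Rightarrow> nat \<Rightarrow> nat list \<Rightarrow> bool" where
  "transitivity_path I c a bs \<longleftrightarrow>
     2 \<le> length bs \<and> hd bs = c \<and> last bs = a \<and> sorted_wrt (>) bs \<and>
     (\<forall>i. Suc i < length bs \<longrightarrow> count I (bs ! i, bs ! Suc i) > 0)"

text \<open>
  Inserting \<open>0\<close> only matters when there is no transitivity path, since the values along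
  paths are positive.
\<close>

definition tc_number :: "(nat \<times> nat) multiset \<Rightarrow> nat \<Rightarrow> nat \<Rightarrow> nat" where
  "tc_number I c a =
     Max (insert 0 {count I (bs ! 0, bs ! 1) | bs. transitivity_path I c a bs})"

definition transitive_closure :: "nat \<Rightarrow> (nat \<times> nat) multiset \<Rightarrow> (nat \<times> nat) multiset" where
  "transitive_closure n I = (\<Sum>(c, a) \<in> index_pairs n. replicate_mset (tc_number I c a) (c, a))"

definition tree_ascents :: "weak_composition \<Rightarrow> ptree \<Rightarrow> (nat \<times> nat) set" where
  "tree_ascents s T =
     {(a, c). a < c \<and> descendant s T a c \<and>
        \<not> belongs a (child T c (part s c)) \<and>
        (\<forall>b. a < b \<and> b < c \<and> descendant s T a b \<longrightarrow> belongs a (child T b (part s b))) \<and>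
        (part s a > 0 \<longrightarrow> child T a (part s a) = Leaf)}"

text \<open>
  Tree-ascents are pairs \<open>(a, c)\<close> and tree-inversions are pairs \<open>(c, a)\<close>, hence the swap.
  An \<open>s\<close>-decreasing tree is determined by its tree-inversions.
\<close>

definition tree_plus :: "weak_composition \<Rightarrow> ptree \<Rightarrow> (nat \<times> nat) set \<Rightarrow> ptree" where
  "tree_plus s T A =
     (THE R. s_decreasing_tree s R \<and>
        tree_inversions s R =
          transitive_closure (length s) (tree_inversions s T + mset_set (prod.swap ` A)))"

definition pure_interval :: "weak_composition \<Rightarrow> ptree set \<Rightarrow> bool" where
  "pure_interval s I \<longleftrightarrow>
     (\<exists>T A. s_decreasing_tree s T \<and> A \<subseteq> tree_ascents s T \<and>
        I = s_weak_interval s T (tree_plus s T A))"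

definition Perm :: "weak_composition \<Rightarrow> ptree set set" where
  "Perm s = {I. pure_interval s I}"

lemma finite_index_pairs [simp]: "finite (index_pairs n)"
  by (rule finite_subset[of _ "{1..n} \<times> {1..n}"]) (auto simp: index_pairs_def)

lemma count_sum_replicate_mset:
  assumes "finite P"
  shows "count (\<Sum>(c, a) \<in> P. replicate_mset (f c a) (c, a)) (c, a) =
           (if (c, a) \<in> P then f c a else 0)"
  using assms by (induction P rule: finite_induct) (auto split: if_splits)

lemma count_tree_inversions:
  "count (tree_inversions s T) (c, a) =
     (if (c, a) \<in> index_pairs (length s) then tree_inversion_number s T c a else 0)"
  unfolding tree_inversions_def by (rule count_sum_replicate_mset) simp

lemma count_transitive_closure:
  "count (transitive_closure n I) (c, a) = (if (c, a) \<in> index_pairs n then tc_number I c a else 0)"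
  unfolding transitive_closure_def by (rule count_sum_replicate_mset) simp

end

theory Submission
  imports Defs
begin

text \<open>
  A pure interval is described by the inversion numbers \<open>l\<close> and \<open>u\<close> of its two ends. Call
  \<open>a < c\<close> glued when \<open>u(c,a) > 0\<close> and \<open>l(c,a) < s(c)\<close>: somewhere in the face, \<open>a\<close> touches
  \<open>c\<close>. It turns out that \<open>(l, u)\<close> comes from a pure interval if and only if \<open>l\<close> and \<open>u\<close> are
  inversion numbers of trees, \<open>l \<le> u \<le> l + 1\<close>, a pair \<open>a < b\<close> whose number varies behaves
  identically with respect to every \<open>c > b\<close>, and two nodes \<open>a < b\<close> with \<open>s(b) > 0\<close> that
  cross \<open>c\<close> at the same place are glued to each other or to a common node strictly between \<open>b\<close> and \<open>c\<close>. These
  conditions are inherited by the pointwise maximum of the lower ends and minimum of the upper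
  ends of two faces, because being glued in the intersection means being glued in both faces.
\<close>

text \<open>Ascents themselves do not pass to intersections: the lower end of an intersection is a
  new tree, and its ascents need not be ascents of the given lower ends. The conditions on
  \<open>(l, u)\<close> therefore mention no ascents. They are recovered as the varying pairs
  \<open>a < c\<close> such that \<open>a\<close> is glued to no node smaller than \<open>c\<close>.

  The obstacle is that pointwise maxima and minima of inversion numbers need not be inversion
  numbers: transitivity may fail for a maximum, planarity for a minimum. Such a failure needs a pair
  \<open>a < b\<close> that meets the premise of the axiom in one face only. If the faces have a
  common element, this pair varies in the other face, and there \<open>a\<close> and
  \<open>b\<close> behave identically.

  The bound \<open>u \<le> l + 1\<close> makes a pair that varies in the intersection take the same
  two values in both faces.

  The restriction to \<open>s(b) > 0\<close> is due to the axioms: if \<open>s(b) = 0\<close>,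
  neither of them ties \<open>a\<close> to \<open>b\<close>, and both can be ascents past the same
  \<open>c\<close> with no common gluing.\<close>

section \<open>Inversion functions and pure pairs\<close>

text \<open>The last two clauses are transitivity and planarity, the axioms that characterize
  inversion numbers of decreasing trees; \<open>decreasing_exists\<close> rebuilds the tree. The
  value \<open>0\<close> off the index pairs lets all clauses range over arbitrary numbers and makes
  equality of functions meaningful.\<close>

definition multi_inversion :: "nat \<Rightarrow> (nat \<Rightarrow> nat) \<Rightarrow> (nat \<Rightarrow> nat \<Rightarrow> nat) \<Rightarrow> bool" where
  "multi_inversion n p x \<longleftrightarrow>
     (\<forall>c a. (c, a) \<notin> index_pairs n \<longrightarrow> x c a = 0) \<and> (\<forall>c a. x c a \<le> p c) \<and>
     (\<forall>a b c. a < b \<and> b < c \<longrightarrow> x b a = 0 \<or> x c b \<le> x c a) \<and>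
     (\<forall>a b c. a < b \<and> b < c \<longrightarrow> x b a = p b \<or> x c a \<le> x c b)"

text \<open>In a tree with inversion numbers \<open>x\<close> this says that \<open>a\<close> is a descendant of \<open>c\<close>.\<close>

definition below :: "(nat \<Rightarrow> nat \<Rightarrow> nat) \<Rightarrow> nat \<Rightarrow> nat \<Rightarrow> bool" where
  "below x a c \<longleftrightarrow> a < c \<and> (\<forall>y > c. x y a = x y c)"

text \<open>Tree-ascents expressed by inversion numbers alone; \<open>tree_ascents_iff\<close> shows
  the agreement. The last clause encodes the empty right child.\<close>

definition ascent :: "nat \<Rightarrow> (nat \<Rightarrow> nat) \<Rightarrow> (nat \<Rightarrow> nat \<Rightarrow> nat) \<Rightarrow> nat \<Rightarrow> nat \<Rightarrow> bool" where
  "ascent n p x a c \<longleftrightarrow>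
     (c, a) \<in> index_pairs n \<and> below x a c \<and> x c a < p c \<and>
     (\<forall>b. b < c \<and> below x a b \<longrightarrow> x b a = p b) \<and>
     (p a > 0 \<longrightarrow> (\<forall>e. below x e a \<longrightarrow> x a e < p a))"

definition glued :: "(nat \<Rightarrow> nat) \<Rightarrow> (nat \<Rightarrow> nat \<Rightarrow> nat) \<Rightarrow> (nat \<Rightarrow> nat \<Rightarrow> nat) \<Rightarrow> nat \<Rightarrow> nat \<Rightarrow> bool" where
  "glued p l u a c \<longleftrightarrow> a < c \<and> 0 < u c a \<and> l c a < p c"

definition pure_pair ::
  "nat \<Rightarrow> (nat \<Rightarrow> nat) \<Rightarrow> (nat \<Rightarrow> nat \<Rightarrow> nat) \<Rightarrow> (nat \<Rightarrow> nat \<Rightarrow> nat) \<Rightarrow> bool" where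
  "pure_pair n p l u \<longleftrightarrow>
     multi_inversion n p l \<and> multi_inversion n p u \<and>
     (\<forall>c a. l c a \<le> u c a \<and> u c a \<le> Suc (l c a)) \<and>
     (\<forall>a b c. a < b \<and> b < c \<and> l b a < u b a \<longrightarrow> l c a = l c b \<and> u c a = u c b) \<and>
     (\<forall>a b c. a < b \<and> b < c \<and> 0 < p b \<and> l c b < u c b \<and> l c a = l c b \<and> u c a = u c b \<and>
        \<not> glued p l u a b \<longrightarrow> (\<exists>d. b < d \<and> d < c \<and> glued p l u a d \<and> glued p l u b d))"

section \<open>Gluing, and intersections of pure pairs\<close>

lemma multi_inversion_outside: "multi_inversion n p x \<Longrightarrow> (c, a) \<notin> index_pairs n \<Longrightarrow> x c a = 0"
  and multi_inversion_le: "multi_inversion n p x \<Longrightarrow> x c a \<le> p c"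
  and multi_inversion_trans:
    "multi_inversion n p x \<Longrightarrow> a < b \<Longrightarrow> b < c \<Longrightarrow> x b a = 0 \<or> x c b \<le> x c a"
  and multi_inversion_planar:
    "multi_inversion n p x \<Longrightarrow> a < b \<Longrightarrow> b < c \<Longrightarrow> x b a = p b \<or> x c a \<le> x c b"
  by (auto simp: multi_inversion_def)

lemma pure_pairD:
  assumes "pure_pair n p l u"
  shows "multi_inversion n p l" "multi_inversion n p u" "l c a \<le> u c a" "u c a \<le> Suc (l c a)"
    and "a < b \<Longrightarrow> b < c \<Longrightarrow> l b a < u b a \<Longrightarrow> l c a = l c b \<and> u c a = u c b"
    and "a < b \<Longrightarrow> b < c \<Longrightarrow> 0 < p b \<Longrightarrow> l c b < u c b \<Longrightarrow> l c a = l c b \<Longrightarrow> u c a = u c b \<Longrightarrow>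
      \<not> glued p l u a b \<Longrightarrow> \<exists>d. b < d \<and> d < c \<and> glued p l u a d \<and> glued p l u b d"
  using assms unfolding pure_pair_def by blast+

text \<open>For a varying pair this is a clause of \<open>pure_pair\<close>. A constant number lies
  strictly between \<open>0\<close> and \<open>p b\<close>, so transitivity and planarity bound the
  numbers at \<open>c\<close> from both sides.\<close>

lemma glued_same:
  assumes "pure_pair n p l u" "glued p l u a b" "b < c"
  shows "l c a = l c b \<and> u c a = u c b"
proof (cases "l b a < u b a")
  case True
  with assms show ?thesis by (meson glued_def pure_pairD(5))
next
  case False
  have ab: "a < b" "0 < u b a" "l b a < p b" using assms(2) by (auto simp: glued_def)
  have "u b a = l b a" using False pure_pairD(3)[OF assms(1), of b a] by simp
  with ab show ?thesis
    using multi_inversion_trans[OF pure_pairD(1)[OF assms(1)] ab(1) assms(3)]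
      multi_inversion_trans[OF pure_pairD(2)[OF assms(1)] ab(1) assms(3)]
      multi_inversion_planar[OF pure_pairD(1)[OF assms(1)] ab(1) assms(3)]
      multi_inversion_planar[OF pure_pairD(2)[OF assms(1)] ab(1) assms(3)] by auto
qed

lemma pure_pair_min_max:
  fixes l u l' u' :: "nat \<Rightarrow> nat \<Rightarrow> nat"
  assumes F: "pure_pair n p l u" and G: "pure_pair n p l' u'"
    and cons: "\<And>c a. max (l c a) (l' c a) \<le> min (u c a) (u' c a)"
  defines "L \<equiv> \<lambda>c a. max (l c a) (l' c a)" and "U \<equiv> \<lambda>c a. min (u c a) (u' c a)"
  shows "pure_pair n p L U"
proof -
  note F1 = pure_pairD[OF F] and G1 = pure_pairD[OF G]
  note miF = multi_inversion_le[OF F1(1)] multi_inversion_le[OF F1(2)]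
    and miG = multi_inversion_le[OF G1(1)] multi_inversion_le[OF G1(2)]
  have cons': "l c a \<le> u c a" "l c a \<le> u' c a" "l' c a \<le> u c a" "l' c a \<le> u' c a" for c a
    using cons[of c a] by auto
  have mL: "multi_inversion n p L"
    unfolding multi_inversion_def
  proof (intro conjI allI impI)
    fix c a assume "(c, a) \<notin> index_pairs n"
    then show "L c a = 0"
      using F1(1) G1(1) by (simp add: L_def multi_inversion_outside)
  next
    fix c a show "L c a \<le> p c" using miF miG by (simp add: L_def)
  next
    fix a b c :: nat assume "a < b \<and> b < c"
    then have h: "a < b" "b < c" by auto
    \<comment> \<open>If only one face has a positive lower value at \<open>(b, a)\<close>, the
      upper value of the other face is positive too while its lower value is \<open>0\<close>. So
      the pair varies there, and that face has equal numbers at \<open>c\<close>.\<close>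
    show "L b a = 0 \<or> L c b \<le> L c a"
      using multi_inversion_trans[OF F1(1) h] multi_inversion_trans[OF G1(1) h]
        F1(5)[OF h] G1(5)[OF h] cons'[of b a] unfolding L_def by linarith
  next
    fix a b c :: nat assume "a < b \<and> b < c"
    then have h: "a < b" "b < c" by auto
    show "L b a = p b \<or> L c a \<le> L c b"
      using multi_inversion_planar[OF F1(1) h] multi_inversion_planar[OF G1(1) h]
        miF(1)[of b a] miG(1)[of b a] unfolding L_def by linarith
  qed
  have mU: "multi_inversion n p U"
    unfolding multi_inversion_def
  proof (intro conjI allI impI)
    fix c a assume "(c, a) \<notin> index_pairs n"
    then show "U c a = 0"
      using F1(2) G1(2) by (simp add: U_def multi_inversion_outside)
  next
    fix c a show "U c a \<le> p c" using miF miG by (simp add: U_def min.coboundedI1)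
  next
    fix a b c :: nat assume "a < b \<and> b < c"
    then have h: "a < b" "b < c" by auto
    show "U b a = 0 \<or> U c b \<le> U c a"
      using multi_inversion_trans[OF F1(2) h] multi_inversion_trans[OF G1(2) h]
      unfolding U_def by linarith
  next
    fix a b c :: nat assume "a < b \<and> b < c"
    then have h: "a < b" "b < c" by auto
    \<comment> \<open>Dually, if only one face has its upper value below \<open>p b\<close>, the
      pair varies in the other face.\<close>
    show "U b a = p b \<or> U c a \<le> U c b"
      using multi_inversion_planar[OF F1(2) h] multi_inversion_planar[OF G1(2) h]
        F1(5)[OF h] G1(5)[OF h] cons'[of b a] miF[of b a] miG[of b a] unfolding U_def by linarith
  qed
  have glued_iff: "glued p L U a c \<longleftrightarrow> glued p l u a c \<and> glued p l' u' a c" for a c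
    by (auto simp: glued_def L_def U_def)
  text \<open>The least node \<open>g\<close> to which \<open>a\<close> and \<open>b\<close> are glued in one face serves for both faces:
    otherwise the other face would force \<open>a\<close> and \<open>b\<close> to cross \<open>g\<close> at the same place, which
    yields a smaller such node.\<close>
  have lca: "\<exists>d. b < d \<and> d < c \<and> glued p L U a d \<and> glued p L U b d"
    if P: "pure_pair n p l1 u1" "pure_pair n p l2 u2"
      and c12: "\<And>c a. max (l1 c a) (l2 c a) \<le> min (u1 c a) (u2 c a)"
      and gi: "\<And>a c. glued p L U a c \<longleftrightarrow> glued p l1 u1 a c \<and> glued p l2 u2 a c"
      and h: "a < b" "b < c" "0 < p b"
      and ng: "\<not> glued p l2 u2 a b"
      and ex: "\<exists>d. b < d \<and> d < c \<and> glued p l2 u2 a d \<and> glued p l2 u2 b d"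
      and same: "\<And>g. b < g \<Longrightarrow> g < c \<Longrightarrow> glued p l2 u2 a g \<Longrightarrow> glued p l2 u2 b g \<Longrightarrow>
         (glued p l1 u1 a g \<and> glued p l1 u1 b g) \<or> (l1 g a = l1 g b \<and> u1 g a = u1 g b)"
    for l1 u1 l2 u2 a b c
  proof -
    define g where "g = (LEAST d. b < d \<and> d < c \<and> glued p l2 u2 a d \<and> glued p l2 u2 b d)"
    have g: "b < g" "g < c" "glued p l2 u2 a g" "glued p l2 u2 b g"
      using LeastI_ex[OF ex] unfolding g_def by auto
    have least: "\<not> (b < d \<and> d < g \<and> glued p l2 u2 a d \<and> glued p l2 u2 b d)" for d
    proof
      assume d: "b < d \<and> d < g \<and> glued p l2 u2 a d \<and> glued p l2 u2 b d"
      then have "d < (LEAST d. b < d \<and> d < c \<and> glued p l2 u2 a d \<and> glued p l2 u2 b d)"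
        by (simp add: g_def)
      from not_less_Least[OF this] d g(2) show False by simp
    qed
    show ?thesis
    proof (cases "glued p l1 u1 a g \<and> glued p l1 u1 b g")
      case True
      then show ?thesis using g gi by blast
    next
      case False
      with same[OF g] have eq: "l1 g a = l1 g b" "u1 g a = u1 g b" by auto
      have "u1 g a = 0 \<or> p g \<le> l1 g a"
        using False eq g h by (auto simp: glued_def)
      \<comment> \<open>The first face is stuck at an extreme value at \<open>g\<close>. Consistency
        moves one end of the second face to that extreme, for \<open>a\<close> and for
        \<open>b\<close>; being glued moves the other end away from it, by exactly one.\<close>
      then have "l2 g a = l2 g b \<and> u2 g a = u2 g b \<and> l2 g b < u2 g b"
      proof
        assume "u1 g a = 0"
        then show ?thesis
          using eq c12[of g a] c12[of g b] g(3,4) pure_pairD(4)[OF P(2), of g a]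
            pure_pairD(4)[OF P(2), of g b] by (auto simp: glued_def)
      next
        assume "p g \<le> l1 g a"
        then show ?thesis
          using eq c12[of g a] c12[of g b] g(3,4) pure_pairD(4)[OF P(2), of g a]
            pure_pairD(4)[OF P(2), of g b] multi_inversion_le[OF pure_pairD(2)[OF P(2)], of g a]
            multi_inversion_le[OF pure_pairD(2)[OF P(2)], of g b] by (auto simp: glued_def)
      qed
      with pure_pairD(6)[OF P(2) h(1) g(1) h(3)] ng least show ?thesis by blast
    qed
  qed
  have X2: "\<exists>d. b < d \<and> d < c \<and> glued p L U a d \<and> glued p L U b d"
    if h: "a < b" "b < c" "0 < p b" and v: "L c b < U c b" and eq: "L c a = L c b" "U c a = U c b"
      and ng: "\<not> glued p L U a b" for a b c
  proof -
    \<comment> \<open>The chain \<open>l \<le> L < U \<le> u \<le> Suc l\<close> leaves no room: at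
      \<open>(c, a)\<close> and \<open>(c, b)\<close> both faces have the ends \<open>L\<close> and
      \<open>U\<close>.\<close>
    have vF: "l c b < u c b" "l c a = l c b" "u c a = u c b"
      and vG: "l' c b < u' c b" "l' c a = l' c b" "u' c a = u' c b"
      using v eq F1(3,4)[of c a] F1(3,4)[of c b] G1(3,4)[of c a] G1(3,4)[of c b]
      unfolding L_def U_def by linarith+
    have cGF: "max (l' c a) (l c a) \<le> min (u' c a) (u c a)" for c a
      using cons[of c a] by (simp add: max.commute min.commute)
    have giGF: "glued p L U a c \<longleftrightarrow> glued p l' u' a c \<and> glued p l u a c" for a c
      using glued_iff by blast
    note exF = F1(6)[OF h vF] and exG = G1(6)[OF h vG]
    consider "glued p l u a b" "\<not> glued p l' u' a b" | "\<not> glued p l u a b" "glued p l' u' a b"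
      | "\<not> glued p l u a b" "\<not> glued p l' u' a b" using ng glued_iff by blast
    then show ?thesis
    proof cases
      case 1
      show ?thesis
        using lca[OF F G cons glued_iff h 1(2) exG[OF 1(2)]] glued_same[OF F 1(1)] by blast
    next
      case 2
      show ?thesis
        using lca[OF G F cGF giGF h 2(1) exF[OF 2(1)]] glued_same[OF G 2(2)] by blast
    next
      case 3
      define dF where "dF = (LEAST d. b < d \<and> d < c \<and> glued p l u a d \<and> glued p l u b d)"
      define dG where "dG = (LEAST d. b < d \<and> d < c \<and> glued p l' u' a d \<and> glued p l' u' b d)"
      have dF: "b < dF" "dF < c" "glued p l u a dF" "glued p l u b dF"
        using LeastI_ex[OF exF[OF 3(1)]] unfolding dF_def by auto
      have dG: "b < dG" "dG < c" "glued p l' u' a dG" "glued p l' u' b dG"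
        using LeastI_ex[OF exG[OF 3(2)]] unfolding dG_def by auto
      have lF: "dF \<le> g" if "b < g" "g < c" "glued p l u a g" "glued p l u b g" for g
        unfolding dF_def using that by (intro Least_le) auto
      have lG: "dG \<le> g" if "b < g" "g < c" "glued p l' u' a g" "glued p l' u' b g" for g
        unfolding dG_def using that by (intro Least_le) auto
      have sF: "l g a = l g b \<and> u g a = u g b" if "dF < g" for g
        using glued_same[OF F dF(3) that] glued_same[OF F dF(4) that] by simp
      have sG: "l' g a = l' g b \<and> u' g a = u' g b" if "dG < g" for g
        using glued_same[OF G dG(3) that] glued_same[OF G dG(4) that] by simp
      \<comment> \<open>The face with the larger least common node is the one to search. At each of
        its common nodes \<open>g\<close>, the other face has already reached its own: either
        \<open>g\<close> is that node, or \<open>a\<close> and \<open>b\<close> agree at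
        \<open>g\<close> by \<open>glued_same\<close>.\<close>
      show ?thesis
      proof (cases "dF \<le> dG")
        case True
        show ?thesis
          by (rule lca[OF F G cons glued_iff h 3(2) exG[OF 3(2)]])
            (use lG sF dF True in \<open>metis le_neq_implies_less le_trans\<close>)
      next
        case False
        show ?thesis
          by (rule lca[OF G F cGF giGF h 3(1) exF[OF 3(1)]])
            (use lF sG dG False in \<open>metis le_neq_implies_less le_trans nat_le_linear\<close>)
      qed
    qed
  qed
  show ?thesis
    unfolding pure_pair_def
  proof (intro conjI allI impI mL mU)
    fix c a show "L c a \<le> U c a" using cons by (simp add: L_def U_def)
    show "U c a \<le> Suc (L c a)" using F1(4)[of c a] by (simp add: L_def U_def min_def max_def)
  next
    fix a b c :: nat assume h: "a < b \<and> b < c \<and> L b a < U b a"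
    then have "l b a < u b a" "l' b a < u' b a" by (auto simp: L_def U_def)
    with h F1(5)[of a b c] G1(5)[of a b c]
    show "L c a = L c b" "U c a = U c b" by (auto simp: L_def U_def)
  qed (use X2 in blast)
qed

section \<open>Adding ascents\<close>

text \<open>The node \<open>y\<close> is the one at which \<open>a\<close> and \<open>b\<close> branch off.\<close>

lemma not_below_cases:
  assumes m: "multi_inversion n p x" and "a < b" "\<not> below x a b"
  obtains y where "b < y" "below x a y" "below x b y" "x y a < x y b" "x b a = 0"
  | y where "b < y" "below x a y" "below x b y" "x y b < x y a" "x b a = p b"
proof -
  define Y where "Y = {y. b < y \<and> x y a \<noteq> x y b}"
  have "x y a = 0" "x y b = 0" if "n < y" for y
    using multi_inversion_outside[OF m] that by (auto simp: index_pairs_def)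
  then have "y \<le> n" if "y \<in> Y" for y
    using that unfolding Y_def by (metis (mono_tags, lifting) mem_Collect_eq not_le)
  then have "Y \<subseteq> {..n}" by blast
  then have fin: "finite Y" using finite_subset by blast
  moreover have "Y \<noteq> {}" using assms(2,3) unfolding below_def Y_def by blast
  ultimately have "Max Y \<in> Y" and mx: "\<And>y. y \<in> Y \<Longrightarrow> y \<le> Max Y"
    by (simp_all del: Max_less_iff)
  moreover have mem: "z \<in> Y \<longleftrightarrow> b < z \<and> x z a \<noteq> x z b" for z by (simp add: Y_def)
  ultimately obtain y where y: "b < y" "x y a \<noteq> x y b" and top: "\<And>z. y < z \<Longrightarrow> x z a = x z b"
    by (metis less_trans not_le)
  \<comment> \<open>The numbers of \<open>a\<close> and \<open>b\<close> differ at \<open>y\<close>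
    and agree at \<open>z\<close>, so transitivity and planarity squeeze the number of
    \<open>y\<close> at \<open>z\<close> between two equal values.\<close>
  have ay: "x z a = x z y" if "y < z" for z
    using multi_inversion_trans[OF m _ that, of a] multi_inversion_planar[OF m _ that, of a]
      multi_inversion_trans[OF m y(1) that] multi_inversion_planar[OF m y(1) that]
      top[OF that] y assms(2) by (elim disjE) auto
  have "below x a y" using ay y(1) assms(2) unfolding below_def by (meson less_trans)
  moreover have "below x b y" using ay top y(1) unfolding below_def by metis
  ultimately have bel: "below x a y" "below x b y" by auto
  show ?thesis
  proof (cases "x y a < x y b")
    case True
    then show ?thesis
      using that(1)[OF y(1) bel] multi_inversion_trans[OF m assms(2) y(1)] by simp
  next
    case False
    then show ?thesis
      using that(2)[OF y(1) bel] multi_inversion_planar[OF m assms(2) y(1)] y(2) by simp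
  qed
qed

lemma below_trans: "below x a b \<Longrightarrow> below x b c \<Longrightarrow> below x a c"
  by (auto simp: below_def)

lemma below_chain: "below x a b \<Longrightarrow> below x a c \<Longrightarrow> b < c \<Longrightarrow> below x b c"
  by (auto simp: below_def)

section \<open>Nodes carried along when ascents are added\<close>

locale ascent_set =
  fixes n :: nat and p :: "nat \<Rightarrow> nat" and x :: "nat \<Rightarrow> nat \<Rightarrow> nat" and A :: "nat \<Rightarrow> nat \<Rightarrow> bool"
  assumes mult: "multi_inversion n p x"
    and asc: "A a c \<Longrightarrow> ascent n p x a c"
begin

text \<open>If \<open>a\<close> is linked to \<open>b\<close>, then \<open>a\<close> is carried along whenever \<open>b\<close> moves past a larger node.\<close>

definition linked :: "nat \<Rightarrow> nat \<Rightarrow> bool" where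
  "linked a b \<longleftrightarrow> A a b \<or> below x a b \<and> 0 < x b a \<and> x b a < p b"

text \<open>Chains of links that end in an ascent past \<open>c\<close>: the pairs whose number
  grows by one when the ascents in \<open>A\<close> are added.\<close>

inductive moved :: "nat \<Rightarrow> nat \<Rightarrow> bool" where
  base: "A a c \<Longrightarrow> moved a c"
| step: "linked a b \<Longrightarrow> moved b c \<Longrightarrow> moved a c"

lemma AD:
  assumes "A a c"
  shows "below x a c" "a < c" "x c a < p c" "below x a b \<Longrightarrow> b < c \<Longrightarrow> x b a = p b"
    "0 < p a \<Longrightarrow> below x e a \<Longrightarrow> x a e < p a" "(c, a) \<in> index_pairs n"
  using asc[OF assms] by (auto simp: ascent_def below_def)

lemma linkedD:
  assumes "linked a b"
  shows "below x a b" "a < b" "x b a < p b"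
  using assms AD by (auto simp: linked_def below_def)

lemma linked_eq: "linked a b \<Longrightarrow> b < y \<Longrightarrow> x y a = x y b"
  using linkedD(1) by (auto simp: below_def)

lemma movedD:
  assumes "moved a c"
  shows "below x a c \<and> x c a < p c \<and> (c, a) \<in> index_pairs n"
  using assms
proof induction
  case (base a c)
  then show ?case using AD by blast
next
  case (step a b c)
  have "below x a c" using step linkedD below_trans by blast
  moreover have "x c a = x c b" using step linked_eq[of a b c] by (auto simp: below_def)
  moreover have "(b, a) \<in> index_pairs n"
    using step(1) AD(6) multi_inversion_outside[OF mult] unfolding linked_def
    by (metis less_irrefl)
  ultimately show ?case using step by (auto simp: index_pairs_def)
qed

lemma moved_less: "moved a c \<Longrightarrow> a < c"
  using movedD by (auto simp: below_def)

text \<open>Otherwise \<open>a\<close> lies in the right child of \<open>d\<close>, which is empty,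
  or to the right of \<open>d\<close>. In the second case they branch off at some \<open>y\<close>.
  If \<open>y < c\<close>, then \<open>d\<close> would not be in the right child of
  \<open>y\<close>; if \<open>y = c\<close>, their numbers at \<open>c\<close> differ; if
  \<open>y > c\<close>, then \<open>a\<close> is right of \<open>c\<close> and has number
  \<open>p c\<close>, unlike \<open>d\<close>.\<close>

lemma A_right_empty:
  assumes "A d c" "0 < p d" "a < d" "x c a = x c d"
  shows "x d a < p d"
proof (rule ccontr)
  assume "\<not> x d a < p d"
  then have e: "x d a = p d" using multi_inversion_le[OF mult, of d a] by simp
  then have nb: "\<not> below x a d" using AD(5)[OF assms(1,2)] by fastforce
  show False
    using mult assms(3) nb
  proof (cases rule: not_below_cases)
    case (1 y) then show False using e assms(2) by simp
  next
    case (2 y)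
    consider "y < c" | "y = c" | "c < y" by linarith
    then show False
    proof cases
      case 1 then show False
        using AD(4)[OF assms(1) 2(3)] 2(4) multi_inversion_le[OF mult, of y a] by simp
    next
      case 3
      then have "x y d = x y c" using AD(1)[OF assms(1)] by (auto simp: below_def)
      then have "x c a = p c"
        using multi_inversion_planar[OF mult _ 3, of a] 2(4) AD(2)[OF assms(1)] assms(3) by auto
      then show False using assms(4) AD(3)[OF assms(1)] by simp
    qed (use 2 assms in simp)
  qed
qed

text \<open>Counterpart of \<open>A_right_empty\<close> with the ascent as the smaller node: if
  \<open>a\<close> were left of \<open>b\<close>, the same three positions of the branching node
  would be contradictory.\<close>

lemma A_passed:
  assumes "A a c" "a < b" "b < c" "x c b = x c a"
  shows "x b a = p b"
proof (rule ccontr)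
  assume e: "x b a \<noteq> p b"
  then have nb: "\<not> below x a b" using AD(4)[OF assms(1)] assms(3) by blast
  show False
    using mult assms(2) nb
  proof (cases rule: not_below_cases)
    case (1 y)
    consider "y < c" | "y = c" | "c < y" by linarith
    then show False
    proof cases
      case a: 1 then show False
        using AD(4)[OF assms(1) 1(2)] 1(4) multi_inversion_le[OF mult, of y b] by simp
    next
      case 3
      then have "x y a = x y c" using AD(1)[OF assms(1)] by (auto simp: below_def)
      then have "x c b = p c"
        using multi_inversion_planar[OF mult _ 3, of b] 1(4) assms(3) by auto
      then show False using assms(4) AD(3)[OF assms(1)] by simp
    qed (use 1 assms in simp)
  next
    case (2 y) then show False using e by simp
  qed
qed

text \<open>If the link from \<open>a\<close> to \<open>c\<close> were an ascent, \<open>a\<close>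
  would be in the right child of \<open>b\<close>, which no link allows. So \<open>a\<close> lies in
  a middle child of \<open>c\<close>, and \<open>b\<close> with it.\<close>

lemma linked_chain:
  assumes "linked a b" "linked a c" "b < c"
  shows "linked b c"
proof -
  have "\<not> A a c" using AD(4)[of a c b] linkedD[OF assms(1)] assms(3) by fastforce
  with assms(2) have "below x a c" "0 < x c a" "x c a < p c" by (auto simp: linked_def)
  then show ?thesis
    using below_chain[OF linkedD(1)[OF assms(1)]] linked_eq[OF assms(1,3)] assms(3)
    by (auto simp: linked_def)
qed

lemma moved_linked: "moved a b \<Longrightarrow> linked a d \<Longrightarrow> d < b \<Longrightarrow> moved d b"
proof (induction arbitrary: d rule: moved.induct)
  case (base a c)
  then show ?case using AD(4)[OF base(1), of d] linkedD[OF base(2)] by fastforce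
next
  case (step a b c)
  consider "d = b" | "d < b" | "b < d" by linarith
  then show ?case
  proof cases
    case 2
    then show ?thesis using linked_chain[OF step(4,1)] step(2) moved.step by blast
  next
    case 3
    then show ?thesis using linked_chain[OF step(1,4)] step by blast
  qed (use step in simp)
qed

lemma moved_trans: "moved a b \<Longrightarrow> moved b c \<Longrightarrow> moved a c"
  by (induction rule: moved.induct) (auto intro: moved.intros simp: linked_def)

lemma moved_chain: "moved a c \<Longrightarrow> moved a b \<Longrightarrow> b < c \<Longrightarrow> moved b c"
proof (induction arbitrary: b rule: moved.induct)
  case (base a c)
  then show ?case using AD(4)[OF base(1), of b] movedD[OF base(2)] by fastforce
next
  case (step a d c)
  consider "b = d" | "d < b" | "b < d" by linarith
  then show ?case
  proof cases
    case 2
    then show ?thesis using step moved_linked by blast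
  next
    case 3
    have "\<not> A a d" using AD(4)[of a d b] movedD[OF step(4)] 3 by fastforce
    then have "below x a d" "0 < x d a" "x d a < p d" using step(1) by (auto simp: linked_def)
    moreover have "below x a b" using movedD[OF step(4)] by blast
    ultimately have "linked b d"
      using below_chain 3 by (auto simp: linked_def below_def)
    then show ?thesis using step(2) moved.step by blast
  qed (use step in simp)
qed

text \<open>This is what transitivity of \<open>raised\<close> requires at a tie. The right child of
  an ascent is empty, so \<open>0 < x b a\<close> puts \<open>a\<close> in a middle child of
  \<open>b\<close>, which is a link.\<close>

lemma moved_transitive:
  "moved b c \<Longrightarrow> a < b \<Longrightarrow> 0 < x b a \<or> moved a b \<Longrightarrow> x c a = x c b \<Longrightarrow> moved a c"
proof (induction rule: moved.induct)
  case (base b c)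
  show ?case
  proof (cases "moved a b")
    case True then show ?thesis using moved_trans base moved.base by blast
  next
    case False
    then have pos: "0 < x b a" using base by simp
    then have "0 < p b" using multi_inversion_le[OF mult, of b a] by simp
    then have lt: "x b a < p b" using A_right_empty base by blast
    have "below x a b"
      using not_below_cases[OF mult base(2)] pos lt by fastforce
    then show ?thesis using pos lt base moved.intros linked_def by blast
  qed
next
  case (step b d c)
  show ?case
  proof (cases "moved a b")
    case True then show ?thesis using moved_trans step moved.step by blast
  next
    case False
    then have pos: "0 < x b a" using step by simp
    have bd: "b < d" "d < c" using linkedD step(1,2) moved_less by blast+
    have eq: "x c a = x c d" using step linked_eq bd by metis
    have ge: "x d b \<le> x d a" using multi_inversion_trans[OF mult step(4) bd(1)] pos by simp
    show ?thesis
    proof (cases "x d a = 0")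
      case True
      \<comment> \<open>Here \<open>x d b = 0\<close> as well, so the link from \<open>b\<close> to
        \<open>d\<close> can only be an ascent, and the argument of the base case applies with
        \<open>d\<close> in place of \<open>c\<close>.\<close>
      then have "A b d" "x d a = x d b" using ge step(1) by (auto simp: linked_def)
      moreover have "0 < p b" using pos multi_inversion_le[OF mult, of b a] by simp
      ultimately have lt: "x b a < p b" using A_right_empty step(4) by blast
      have "below x a b"
        using not_below_cases[OF mult step(4)] pos lt by fastforce
      then show ?thesis using pos lt step(1,2) moved.step linked_def by metis
    next
      case False
      then show ?thesis using step bd eq by simp
    qed
  qed
qed

text \<open>The chain from \<open>a\<close> is followed until it reaches \<open>b\<close> or jumps
  over it to some \<open>d\<close>. After a jump, \<open>A_passed\<close> forces
  \<open>0 < x d b\<close>, and \<open>moved_transitive\<close> carries \<open>b\<close> along with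
  \<open>d\<close>.\<close>

lemma moved_planar:
  "moved a c \<Longrightarrow> a < b \<Longrightarrow> b < c \<Longrightarrow> x b a < p b \<Longrightarrow> \<not> moved a b \<Longrightarrow> x c b = x c a \<Longrightarrow> moved b c"
proof (induction rule: moved.induct)
  case (base a c)
  then show ?case using A_passed by fastforce
next
  case (step a d c)
  have ad: "a < d" "d < c" "x c a = x c d" using linkedD step(1,2) moved_less linked_eq by blast+
  consider "b = d" | "d < b" | "b < d" by linarith
  then show ?case
  proof cases
    case 2
    have "x b a = x b d" using linked_eq step(1) 2 by blast
    moreover have "\<not> moved d b" using step(1,7) moved.step by blast
    ultimately show ?thesis using step 2 ad by simp
  next
    case 3
    have ge: "x d a \<le> x d b" using multi_inversion_planar[OF mult step(4) 3] step(6) by simp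
    have "x d b \<noteq> 0"
    proof
      assume "x d b = 0"
      with ge step(1) have "A a d" "x d b = x d a" by (auto simp: linked_def)
      then show False using A_passed step(4,6) 3 by fastforce
    qed
    then show ?thesis using moved_transitive[OF step(2) 3] step(8) ad by simp
  qed (use step in simp)
qed

definition raised :: "nat \<Rightarrow> nat \<Rightarrow> nat" where
  "raised c a = x c a + of_bool (moved a c)"

text \<open>Numbers grow by at most one, so an inequality that holds for \<open>x\<close> at
  \<open>c\<close> can break only at a tie. Ties are settled by \<open>moved_transitive\<close>,
  \<open>moved_chain\<close> and \<open>moved_planar\<close>.\<close>

lemma multi_inversion_raised: "multi_inversion n p raised"
  unfolding multi_inversion_def
proof (intro conjI allI impI)
  fix c a assume "(c, a) \<notin> index_pairs n"
  then show "raised c a = 0"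
    using movedD multi_inversion_outside[OF mult] by (auto simp: raised_def)
next
  fix c a show "raised c a \<le> p c"
    using movedD[of a c] multi_inversion_le[OF mult, of c a] by (auto simp: raised_def)
next
  fix a b c :: nat assume "a < b \<and> b < c"
  then have h: "a < b" "b < c" by auto
  show "raised b a = 0 \<or> raised c b \<le> raised c a"
  proof (cases "0 < x b a \<or> moved a b")
    case True
    moreover have "x c b \<le> x c a" if "moved a b" using movedD[OF that] h by (auto simp: below_def)
    ultimately have "x c b \<le> x c a" using multi_inversion_trans[OF mult h] by auto
    then show ?thesis
      using moved_transitive[OF _ h(1) True, of c]
      by (cases "x c a = x c b") (auto simp: raised_def)
  qed (simp add: raised_def)
next
  fix a b c :: nat assume "a < b \<and> b < c"
  then have h: "a < b" "b < c" by auto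
  show "raised b a = p b \<or> raised c a \<le> raised c b"
  proof (cases "moved a b")
    case True
    then have "x c a = x c b" using movedD[OF True] h by (auto simp: below_def)
    then show ?thesis using moved_chain[OF _ True h(2)] by (auto simp: raised_def)
  next
    case False
    then have r: "raised b a = x b a" by (simp add: raised_def)
    show ?thesis
    proof (cases "x b a < p b")
      case True
      then have "x c a \<le> x c b" using multi_inversion_planar[OF mult h] by simp
      then show ?thesis
        using moved_planar[OF _ h True False]
        by (cases "x c a = x c b") (auto simp: raised_def)
    qed (use r multi_inversion_le[OF mult, of b a] in simp)
  qed
qed

text \<open>At the last node of the chain, \<open>A_passed\<close> puts \<open>b\<close> at the
  right end, whereas \<open>A_right_empty\<close> leaves nothing there.\<close>

lemma moved_A_False:
  "moved d c \<Longrightarrow> A b c \<Longrightarrow> b < d \<Longrightarrow> x c d = x c b \<Longrightarrow> 0 < p d \<Longrightarrow> False"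
proof (induction rule: moved.induct)
  case (base d c)
  then have "x d b < p d" using A_right_empty[of d c b] by simp
  moreover have "x d b = p d" using A_passed[of b c d] base AD(2)[OF base(1)] by simp
  ultimately show ?case by simp
next
  case (step d e c)
  have "d < e" "e < c" "x c d = x c e" "0 < p e"
    using linkedD[OF step(1)] step(2) moved_less linked_eq[OF step(1)] by auto
  then show ?case using step by simp
qed

text \<open>The half of \<open>glued\<close> that concerns the upper end, for an ascent
  \<open>b\<close>. By \<open>moved_A_False\<close> the chain from \<open>a\<close> cannot jump over
  \<open>b\<close>; it meets \<open>b\<close> by a link, or it ends before \<open>b\<close> in
  another ascent past \<open>c\<close>, where \<open>A_passed\<close> applies.\<close>

lemma moved_A_pos:
  "moved a c \<Longrightarrow> A b c \<Longrightarrow> a < b \<Longrightarrow> 0 < p b \<Longrightarrow> x c a = x c b \<Longrightarrow> 0 < raised b a"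
proof (induction rule: moved.induct)
  case (base a c)
  then show ?case using A_passed[of a c b] AD(2)[OF base(2)] by (simp add: raised_def)
next
  case (step a d c)
  have ad: "a < d" "d < c" "x c a = x c d" "0 < p d"
    using linkedD[OF step(1)] step(2) moved_less linked_eq[OF step(1)] by auto
  consider "b = d" | "d < b" | "b < d" by linarith
  then show ?case
  proof cases
    case 1
    then show ?thesis using step(1) moved.base by (auto simp: raised_def linked_def)
  next
    case 2
    then show ?thesis
      using step ad linked_eq[OF step(1) 2] moved.step[OF step(1)] by (auto simp: raised_def)
  next
    case 3
    then show ?thesis using moved_A_False[OF step(2,4)] ad step by simp
  qed
qed

lemma linked_glued:
  assumes "linked a b"
  shows "glued p x raised a b"
proof -
  have "0 < raised b a"
    using assms moved.base[of a b] by (cases "A a b") (simp_all add: linked_def raised_def)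
  then show ?thesis using linkedD[OF assms] by (simp add: glued_def)
qed

text \<open>The last clause of \<open>pure_pair\<close> for \<open>raised\<close>. The witness is
  the first node after \<open>b\<close> on its chain to which \<open>a\<close> is glued; there is
  one because \<open>a\<close> is glued to the last node, an ascent past \<open>c\<close>. Beyond
  each link the two linked nodes agree, so \<open>b\<close> is glued to the witness too.\<close>

lemma moved_common_glued:
  "moved b c \<Longrightarrow> moved a c \<Longrightarrow> a < b \<Longrightarrow> 0 < p b \<Longrightarrow> x c a = x c b \<Longrightarrow> \<not> glued p x raised a b \<Longrightarrow>
     \<exists>d. b < d \<and> d < c \<and> glued p x raised a d \<and> glued p x raised b d"
proof (induction rule: moved.induct)
  case (base b c)
  then show ?case using A_right_empty[of b c a] moved_A_pos[of a c b] by (simp add: glued_def)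
next
  case (step b e c)
  have be: "b < e" "e < c" "x c b = x c e" "0 < p e"
    using linkedD[OF step(1)] step(2) moved_less linked_eq[OF step(1)] by auto
  show ?case
  proof (cases "glued p x raised a e")
    case True
    then show ?thesis using be linked_glued[OF step(1)] by blast
  next
    case False
    then obtain d where d: "e < d" "d < c" "glued p x raised a d" "glued p x raised e d"
      using step be by auto
    moreover have "glued p x raised b d"
      using d(4) linked_eq[OF step(1) d(1)] moved.step[OF step(1)] be
      by (auto simp: glued_def raised_def)
    ultimately show ?thesis using be by (meson less_trans)
  qed
qed

lemma pure_pair_raised: "pure_pair n p x raised"
  unfolding pure_pair_def
proof (intro conjI allI impI mult multi_inversion_raised)
  fix c a show "x c a \<le> raised c a" "raised c a \<le> Suc (x c a)" by (auto simp: raised_def)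
next
  fix a b c :: nat assume h: "a < b \<and> b < c \<and> x b a < raised b a"
  then have m: "moved a b" by (auto simp: raised_def split: if_splits)
  show e: "x c a = x c b" using movedD[OF m] h by (auto simp: below_def)
  show "raised c a = raised c b"
    using e moved_trans[OF m, of c] moved_chain[OF _ m, of c] h by (auto simp: raised_def)
next
  fix a b c
  assume "a < b \<and> b < c \<and> 0 < p b \<and> x c b < raised c b \<and> x c a = x c b \<and>
    raised c a = raised c b \<and> \<not> glued p x raised a b"
  moreover from this have "moved b c" "moved a c"
    by (cases "moved a c"; cases "moved b c"; simp add: raised_def)+
  ultimately show "\<exists>d. b < d \<and> d < c \<and> glued p x raised a d \<and> glued p x raised b d"
    using moved_common_glued by blast
qed

text \<open>\<open>A\<close> can be read off from \<open>raised\<close>: a chain that starts with a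
  link to some \<open>b\<close> has \<open>x b a < p b\<close>, which an ascent from
  \<open>a\<close> past a larger \<open>c\<close> forbids.\<close>

lemma A_iff: "A a c \<longleftrightarrow> ascent n p x a c \<and> x c a < raised c a"
proof
  assume "A a c" then show "ascent n p x a c \<and> x c a < raised c a"
    using asc moved.base by (auto simp: raised_def)
next
  assume h: "ascent n p x a c \<and> x c a < raised c a"
  then have "moved a c" by (auto simp: raised_def split: if_splits)
  then show "A a c"
  proof cases
    case (step b)
    then have "x b a = p b" using h linkedD(1) moved_less by (auto simp: ascent_def)
    then show ?thesis using linkedD(3)[OF step(1)] by simp
  qed
qed

end

section \<open>Pure pairs are transitive closures\<close>

text \<open>If some \<open>b\<close> or \<open>e\<close> violated the condition on intermediate
  nodes or on the right child, it would cross \<open>c\<close> at the same place as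
  \<open>a\<close>. The last clause of \<open>pure_pair\<close> would then glue \<open>a\<close> to
  a node before \<open>c\<close>.\<close>

lemma pure_pair_ascent:
  assumes P: "pure_pair n p l u" and v: "l c a < u c a"
    and ng: "\<And>d. d < c \<Longrightarrow> \<not> glued p l u a d"
  shows "ascent n p l a c"
proof -
  note P1 = pure_pairD[OF P]
  have ip: "(c, a) \<in> index_pairs n" using v multi_inversion_outside[OF P1(2), of c a] by auto
  then have ac: "a < c" by (auto simp: index_pairs_def)
  have u_eq: "u c a = Suc (l c a)" using v P1(4)[of c a] by simp
  have bel: "below l a c" using P1(5)[OF ac _ v] ac by (auto simp: below_def)
  have lt: "l c a < p c" using v multi_inversion_le[OF P1(2), of c a] by simp
  have iii: "l b a = p b" if b: "b < c" "below l a b" for b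
  proof (rule ccontr)
    assume "l b a \<noteq> p b"
    then have lb: "l b a < p b" using multi_inversion_le[OF P1(1), of b a] by simp
    have ab: "a < b" using b by (simp add: below_def)
    have u0: "u b a = 0" using ng[OF b(1)] lb ab by (auto simp: glued_def)
    have leq: "l c a = l c b" using b by (auto simp: below_def)
    have "u c a \<le> u c b" using multi_inversion_planar[OF P1(2) ab b(1)] u0 lb by auto
    then have "u c a = u c b" using u_eq leq P1(4)[of c b] by simp
    then show False using P1(6)[OF ab b(1)] lb leq v ng b(1)
      by (metis gr_implies_not_zero not_gr_zero)
  qed
  have iv: "l a e < p a" if e: "0 < p a" "below l e a" for e
  proof (rule ccontr)
    assume "\<not> l a e < p a"
    then have le: "l a e = p a" using multi_inversion_le[OF P1(1), of a e] by simp
    have ea: "e < a" using e by (simp add: below_def)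
    have leq: "l c e = l c a" using e ac by (auto simp: below_def)
    have "u c a \<le> u c e"
      using multi_inversion_trans[OF P1(2) ea ac] le e(1) P1(3)[of a e] by auto
    then have "u c e = u c a" using u_eq leq P1(4)[of c e] by simp
    moreover have "\<not> glued p l u e a" using le by (simp add: glued_def)
    ultimately show False using P1(6)[OF ea ac e(1) v leq] ng by blast
  qed
  show ?thesis using ip bel lt iii iv by (auto simp: ascent_def)
qed

section \<open>Values of the transitive closure along paths\<close>

lemma tc_number_eqI:
  assumes "\<And>bs. transitivity_path I c a bs \<Longrightarrow> count I (bs ! 0, bs ! 1) \<le> v"
    and "v = 0 \<or> (\<exists>bs. transitivity_path I c a bs \<and> count I (bs ! 0, bs ! 1) = v)"
  shows "tc_number I c a = v"
  unfolding tc_number_def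
proof (rule Max_eqI)
  have "{count I (bs ! 0, bs ! 1) |bs. transitivity_path I c a bs} \<subseteq> {..v}"
    using assms(1) by auto
  then show "finite (insert 0 {count I (bs ! 0, bs ! 1) |bs. transitivity_path I c a bs})"
    using finite_subset by blast
qed (use assms in auto)

lemma transitivity_path_pair:
  "a < c \<Longrightarrow> 0 < count I (c, a) \<Longrightarrow> transitivity_path I c a [c, a]"
  by (auto simp: transitivity_path_def)

lemma transitivity_path_append:
  assumes "transitivity_path I c b xs" "transitivity_path I b a ys"
  shows "transitivity_path I c a (xs @ tl ys)" "(xs @ tl ys) ! 0 = xs ! 0" "(xs @ tl ys) ! 1 = xs ! 1"
proof -
  obtain xs' where xs: "xs = xs' @ [b]" "xs' \<noteq> []"
    using assms(1) unfolding transitivity_path_def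
    by (metis One_nat_def Suc_1 append_butlast_last_id append_self_conv2 le_numeral_extra(4)
        length_0_conv length_Cons list.size(3) not_less_eq_eq zero_le)
  obtain ys' where ys: "ys = b # ys'" "ys' \<noteq> []"
    using assms(2) unfolding transitivity_path_def by (cases ys; cases "tl ys") auto
  have e: "xs @ tl ys = xs' @ ys" by (simp add: xs ys)
  have sx: "sorted_wrt (>) xs'" "\<forall>z \<in> set xs'. b < z" "hd xs' = c"
    using assms(1) xs by (auto simp: transitivity_path_def sorted_wrt_append)
  have sy: "sorted_wrt (>) ys" "\<forall>z \<in> set ys'. z < b" "last ys = a"
    using assms(2) ys by (auto simp: transitivity_path_def)
  have "sorted_wrt (>) (xs' @ ys)"
    using sx sy ys by (auto simp: sorted_wrt_append) (meson less_trans)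
  moreover have "0 < count I ((xs' @ ys) ! i, (xs' @ ys) ! Suc i)" if i: "Suc i < length (xs' @ ys)" for i
  proof (cases "Suc i < length xs")
    case True
    then have "0 < count I (xs ! i, xs ! Suc i)"
      using assms(1) by (simp add: transitivity_path_def)
    moreover have "(xs' @ ys) ! k = xs ! k" if "k < length xs" for k
      using that by (auto simp: xs ys nth_append less_Suc_eq)
    ultimately show ?thesis using True by simp
  next
    case False
    define j where "j = i - length xs'"
    have j: "i = length xs' + j" using False by (simp add: xs j_def)
    then have "Suc j < length ys" using i by simp
    then show ?thesis
      using assms(2) j by (simp add: transitivity_path_def nth_append)
  qed
  ultimately show "transitivity_path I c a (xs @ tl ys)"
    using sx sy xs ys unfolding e transitivity_path_def by (auto simp: Suc_le_eq)
  show "(xs @ tl ys) ! 0 = xs ! 0" "(xs @ tl ys) ! 1 = xs ! 1"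
    using assms(1) by (auto simp: transitivity_path_def nth_append)
qed

text \<open>No path exceeds \<open>u\<close>, since \<open>u\<close> is transitive and dominates
  every edge. Conversely, if the edge \<open>(c, a)\<close> misses the value, the pair varies
  without being an ascent, so \<open>a\<close> is glued to some \<open>d < c\<close>. Then
  \<open>u c a = u c d\<close>, and a path from \<open>c\<close> to \<open>d\<close> found
  recursively, extended to \<open>a\<close>, keeps its first edge and hence its value.\<close>

lemma tc_number_pure_pair:
  assumes P: "pure_pair n p l u"
    and I: "\<And>c a. count I (c, a) = l c a + of_bool (ascent n p l a c \<and> l c a < u c a)"
    and ac: "a < c"
  shows "tc_number I c a = u c a"
proof (rule tc_number_eqI)
  note P1 = pure_pairD[OF P]
  have le: "count I (c, a) \<le> u c a" for c a
    using P1(3)[of c a] by (auto simp: I)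
  fix bs assume bs: "transitivity_path I c a bs"
  have "count I (bs ! 0, bs ! 1) \<le> u (bs ! 0) (bs ! k)" if "0 < k" "k < length bs" for k
    using that
  proof (induction k rule: nat_induct_non_zero)
    case 1 then show ?case using le by simp
  next
    case (Suc k)
    have "bs ! k < bs ! 0" "bs ! Suc k < bs ! k"
      using bs Suc by (auto simp: transitivity_path_def sorted_wrt_iff_nth_less)
    moreover have "0 < count I (bs ! k, bs ! Suc k)"
      using bs Suc by (simp add: transitivity_path_def)
    then have "0 < u (bs ! k) (bs ! Suc k)" using le less_le_trans by blast
    ultimately show ?case
      using Suc multi_inversion_trans[OF P1(2), of "bs ! Suc k" "bs ! k" "bs ! 0"] by fastforce
  qed
  from this[of "length bs - 1"] show "count I (bs ! 0, bs ! 1) \<le> u c a"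
    using bs unfolding transitivity_path_def
    by (metis One_nat_def Suc_1 diff_less hd_conv_nth last_conv_nth le_zero_eq list.size(3)
        nat.distinct(1) not_less_eq_eq zero_less_diff zero_less_one length_greater_0_conv not_le)
next
  note P1 = pure_pairD[OF P]
  have "0 < u c a \<longrightarrow> (\<exists>bs. transitivity_path I c a bs \<and> count I (bs ! 0, bs ! 1) = u c a)"
    using ac
  proof (induction "c - a" arbitrary: a c rule: less_induct)
    case less
    show ?case
    proof (intro impI)
      assume pos: "0 < u c a"
      show "\<exists>bs. transitivity_path I c a bs \<and> count I (bs ! 0, bs ! 1) = u c a"
      proof (cases "count I (c, a) = u c a")
        case True
        then show ?thesis
          using transitivity_path_pair[of a c I] less(2) pos by (intro exI[of _ "[c, a]"]) auto
      next
        case False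
        then have "l c a < u c a" "\<not> ascent n p l a c"
          using P1(3,4)[of c a] by (cases "l c a < u c a"; auto simp: I)+
        then obtain d where d: "d < c" "glued p l u a d" using pure_pair_ascent[OF P] by blast
        then have ad: "a < d" "0 < u d a" by (auto simp: glued_def)
        have eq: "u c a = u c d" using glued_same[OF P d(2,1)] by simp
        obtain xs ys where "transitivity_path I c d xs" "count I (xs ! 0, xs ! 1) = u c d"
          and "transitivity_path I d a ys"
          using less(1)[of c d] less(1)[of d a] d ad pos eq less(2) by (auto simp: diff_less_mono2 diff_less_mono)
        then show ?thesis
          using transitivity_path_append[of I c d xs a ys] eq by auto
      qed
    qed
  qed
  then show "u c a = 0 \<or> (\<exists>bs. transitivity_path I c a bs \<and> count I (bs ! 0, bs ! 1) = u c a)"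
    by auto
qed

section \<open>Inversion numbers of trees\<close>

text \<open>The label set is left free so that children inherit the property and structural
  induction applies.\<close>

definition decreasing :: "weak_composition \<Rightarrow> ptree \<Rightarrow> bool" where
  "decreasing s T \<longleftrightarrow> distinct (labels T) \<and>
     (\<forall>y ts. Node y ts \<in> subtrees T \<longrightarrow>
        length ts = part s y + 1 \<and> (\<forall>t \<in> set ts. \<forall>a \<in> set (labels t). a < y))"

lemma s_decreasing_tree_iff:
  "s_decreasing_tree s T \<longleftrightarrow> decreasing s T \<and> set (labels T) = {1..length s}"
  by (auto simp: s_decreasing_tree_def decreasing_def)

section \<open>Decomposition of a decreasing tree at its root\<close>

lemma distinct_concat_map_iff:
  "distinct (concat (map f ts)) \<longleftrightarrow>
     (\<forall>i < length ts. distinct (f (ts ! i))) \<and>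
     (\<forall>i < length ts. \<forall>j < length ts. i \<noteq> j \<longrightarrow> set (f (ts ! i)) \<inter> set (f (ts ! j)) = {})"
proof (induction ts)
  case (Cons t ts)
  have "set (f t) \<inter> set (concat (map f ts)) = {} \<longleftrightarrow>
      (\<forall>t' \<in> set ts. set (f t) \<inter> set (f t') = {})"
    by auto
  also have "\<dots> \<longleftrightarrow> (\<forall>j < length ts. set (f t) \<inter> set (f (ts ! j)) = {})"
    by (simp add: all_set_conv_all_nth)
  finally have "set (f t) \<inter> set (concat (map f ts)) = {} \<longleftrightarrow>
      (\<forall>j < length ts. set (f t) \<inter> set (f (ts ! j)) = {})" .
  moreover have "distinct (concat (map f (t # ts))) \<longleftrightarrow> distinct (f t) \<and>
      distinct (concat (map f ts)) \<and> set (f t) \<inter> set (concat (map f ts)) = {}"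
    by simp
  ultimately show ?case
    unfolding Cons length_Cons All_less_Suc2 nth_Cons_0 nth_Cons_Suc
    by (metis Int_commute nat.distinct(1) nat.inject)
qed simp

lemma labels_Node_iff:
  "a \<in> set (labels (Node y ts)) \<longleftrightarrow> a = y \<or> (\<exists>i < length ts. a \<in> set (labels (ts ! i)))"
proof -
  have "a \<in> set (labels (Node y ts)) \<longleftrightarrow> a = y \<or> (\<exists>t \<in> set ts. a \<in> set (labels t))" by auto
  then show ?thesis by (metis in_set_conv_nth)
qed

lemma subtrees_Node_iff:
  "t \<in> subtrees (Node y ts) \<longleftrightarrow> t = Node y ts \<or> (\<exists>i < length ts. t \<in> subtrees (ts ! i))"
proof -
  have "t \<in> subtrees (Node y ts) \<longleftrightarrow> t = Node y ts \<or> (\<exists>t' \<in> set ts. t \<in> subtrees t')" by auto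
  then show ?thesis by (metis in_set_conv_nth)
qed

lemma decreasing_Leaf [simp]: "decreasing s Leaf"
  by (simp add: decreasing_def)

lemma decreasing_Node:
  "decreasing s (Node y ts) \<longleftrightarrow>
     length ts = part s y + 1 \<and>
     (\<forall>i < length ts. decreasing s (ts ! i) \<and> (\<forall>a \<in> set (labels (ts ! i)). a < y)) \<and>
     (\<forall>i < length ts. \<forall>j < length ts. i \<noteq> j \<longrightarrow>
        set (labels (ts ! i)) \<inter> set (labels (ts ! j)) = {})"
proof -
  define Q where "Q z us \<longleftrightarrow> length us = part s z + 1 \<and> (\<forall>t \<in> set us. \<forall>a \<in> set (labels t). a < z)"
    for z us
  have D: "decreasing s T \<longleftrightarrow> distinct (labels T) \<and> (\<forall>z us. Node z us \<in> subtrees T \<longrightarrow> Q z us)" for T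
    by (simp add: decreasing_def Q_def)
  have "(\<forall>z us. Node z us \<in> subtrees (Node y ts) \<longrightarrow> Q z us) \<longleftrightarrow>
      Q y ts \<and> (\<forall>i < length ts. \<forall>z us. Node z us \<in> subtrees (ts ! i) \<longrightarrow> Q z us)"
    unfolding subtrees_Node_iff by blast
  moreover have "distinct (labels (Node y ts)) \<longleftrightarrow>
      (\<forall>i < length ts. y \<notin> set (labels (ts ! i))) \<and> distinct (concat (map labels ts))"
    using all_set_conv_all_nth[of ts "\<lambda>t. y \<notin> set (labels t)"] by simp
  moreover have "Q y ts \<longleftrightarrow> length ts = part s y + 1 \<and>
      (\<forall>i < length ts. \<forall>a \<in> set (labels (ts ! i)). a < y)"
    unfolding Q_def all_set_conv_all_nth[of ts] ..
  moreover have "y \<notin> set (labels (ts ! i))" if "\<forall>a \<in> set (labels (ts ! i)). a < y" for i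
    using that by blast
  ultimately show ?thesis
    unfolding D distinct_concat_map_iff by metis
qed

lemma decreasing_NodeD:
  assumes "decreasing s (Node y ts)"
  shows "length ts = part s y + 1"
    and "i < length ts \<Longrightarrow> decreasing s (ts ! i)"
    and "i < length ts \<Longrightarrow> a \<in> set (labels (ts ! i)) \<Longrightarrow> a < y"
    and "i < length ts \<Longrightarrow> j < length ts \<Longrightarrow> a \<in> set (labels (ts ! i)) \<Longrightarrow>
      a \<in> set (labels (ts ! j)) \<Longrightarrow> i = j"
  using assms unfolding decreasing_Node disjoint_iff by blast+

lemma labels_le_root:
  assumes "decreasing s (Node y ts)" "z \<in> set (labels (Node y ts))"
  shows "z \<le> y"
  using assms(2) decreasing_NodeD(3)[OF assms(1)] unfolding labels_Node_iff
  by (auto intro: less_imp_le)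

lemma ptree_induct_nth [case_names Leaf Node]:
  assumes "P Leaf" "\<And>y ts. (\<And>i. i < length ts \<Longrightarrow> P (ts ! i)) \<Longrightarrow> P (Node y ts)"
  shows "P T"
  by (induction T) (use assms in auto)

lemma labels_subtree: "t \<in> subtrees T \<Longrightarrow> set (labels t) \<subseteq> set (labels T)"
proof (induction T rule: ptree_induct_nth)
  case (Node y ts)
  then show ?case
    unfolding subtrees_Node_iff using labels_Node_iff by blast
qed simp

lemma label_subtree: "Node y ts \<in> subtrees T \<Longrightarrow> y \<in> set (labels T)"
  using labels_subtree by fastforce

lemma children_root:
  assumes "decreasing s (Node y ts)"
  shows "children (Node y ts) y = ts"
  unfolding children_def
proof (rule the_equality)
  fix us assume "Node y us \<in> subtrees (Node y ts)"
  then show "us = ts"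
    unfolding subtrees_Node_iff using label_subtree decreasing_NodeD(3)[OF assms] by blast
qed simp

lemma children_child:
  assumes "decreasing s (Node y ts)" "i < length ts" "c \<in> set (labels (ts ! i))"
  shows "children (Node y ts) c = children (ts ! i) c"
proof -
  have "Node c us \<in> subtrees (Node y ts) \<longleftrightarrow> Node c us \<in> subtrees (ts ! i)" for us
    unfolding subtrees_Node_iff
    using decreasing_NodeD(3,4)[OF assms(1)] assms label_subtree by blast
  then show ?thesis by (simp add: children_def)
qed

lemma children_subtree:
  "decreasing s T \<Longrightarrow> c \<in> set (labels T) \<Longrightarrow> Node c (children T c) \<in> subtrees T"
proof (induction T rule: ptree_induct_nth)
  case (Node y ts)
  show ?case
  proof (cases "c = y")
    case True
    then show ?thesis using children_root[OF Node(2)] by simp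
  next
    case False
    then obtain i where i: "i < length ts" "c \<in> set (labels (ts ! i))"
      using Node(3) labels_Node_iff by blast
    then show ?thesis
      using Node(1)[OF i(1) decreasing_NodeD(2)[OF Node(2) i(1)] i(2)] children_child[OF Node(2) i]
        subtrees_Node_iff by metis
  qed
qed simp

lemma length_children:
  "decreasing s T \<Longrightarrow> c \<in> set (labels T) \<Longrightarrow> length (children T c) = part s c + 1"
  using children_subtree unfolding decreasing_def by blast

lemma labels_child:
  assumes "decreasing s T" "c \<in> set (labels T)" "k \<le> part s c" "a \<in> set (labels (child T c k))"
  shows "a \<in> set (labels T)" "a < c"
proof -
  have k: "k < length (children T c)" using length_children[OF assms(1,2)] assms(3) by simp
  then have "a \<in> set (labels (Node c (children T c)))" using assms(4) labels_Node_iff by blast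
  then show "a \<in> set (labels T)" using labels_subtree[OF children_subtree[OF assms(1,2)]] by blast
  show "a < c"
    using children_subtree[OF assms(1,2)] assms(1,4) nth_mem[OF k] unfolding decreasing_def by blast
qed

lemma left_of_labels:
  assumes "left_of T a c"
  shows "a \<in> set (labels T)" "c \<in> set (labels T)"
proof -
  obtain y ts i j where h: "Node y ts \<in> subtrees T" "i < j" "j < length ts"
    "a \<in> set (labels (ts ! i))" "c \<in> set (labels (ts ! j))"
    using assms unfolding left_of_def by blast
  then have "a \<in> set (labels (Node y ts))" "c \<in> set (labels (Node y ts))"
    unfolding labels_Node_iff by (meson less_trans)+
  then show "a \<in> set (labels T)" "c \<in> set (labels T)" using labels_subtree[OF h(1)] by blast+
qed

lemma left_of_Node:
  "left_of (Node y ts) a c \<longleftrightarrow>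
     (\<exists>i j. i < j \<and> j < length ts \<and> belongs a (ts ! i) \<and> belongs c (ts ! j)) \<or>
     (\<exists>k < length ts. left_of (ts ! k) a c)"
  unfolding left_of_def subtrees_Node_iff by blast

text \<open>With the next three lemmas this covers all positions of \<open>a\<close> relative to
  \<open>c\<close>: \<open>c\<close> is the root, both lie in one child, or the child of
  \<open>a\<close> is left or right of that of \<open>c\<close>. The inductions below run over these
  cases.\<close>

lemma tree_inversion_number_root:
  assumes d: "decreasing s (Node y ts)" and i: "i < length ts" "a \<in> set (labels (ts ! i))"
  shows "tree_inversion_number s (Node y ts) y a = i"
proof -
  have "\<not> left_of (Node y ts) a y"
    unfolding left_of_Node using decreasing_NodeD(3)[OF d] left_of_labels(2) by blast
  moreover have "belongs a (ts ! k) \<longleftrightarrow> k = i" if "k < length ts" for k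
    using decreasing_NodeD(4)[OF d _ _ i(2)] i that by blast
  moreover have le: "i \<le> part s y" using i decreasing_NodeD(1)[OF d] by simp
  ultimately have "\<not> left_of (Node y ts) a y"
    and b: "k \<le> part s y \<Longrightarrow> belongs a (ts ! k) \<longleftrightarrow> k = i" for k
    using decreasing_NodeD(1)[OF d] by auto
  moreover have "0 < k \<and> k < part s y \<and> belongs a (ts ! k) \<longleftrightarrow> k = i \<and> 0 < i \<and> i < part s y" for k
    using b[of k] by auto
  ultimately show ?thesis
    using le b[of 0] unfolding tree_inversion_number_def children_root[OF d] by auto
qed

lemma tree_inversion_number_child:
  assumes d: "decreasing s (Node y ts)" and k: "k < length ts"
    and "a \<in> set (labels (ts ! k))" "c \<in> set (labels (ts ! k))"
  shows "tree_inversion_number s (Node y ts) c a = tree_inversion_number s (ts ! k) c a"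
proof -
  have "left_of (Node y ts) a c \<longleftrightarrow> left_of (ts ! k) a c"
    unfolding left_of_Node using decreasing_NodeD(4)[OF d] assms left_of_labels
    by (metis less_irrefl less_trans)
  then show ?thesis
    unfolding tree_inversion_number_def children_child[OF d k assms(4)] by simp
qed

lemma tree_inversion_number_left:
  assumes "i < j" "j < length ts" "a \<in> set (labels (ts ! i))" "c \<in> set (labels (ts ! j))"
  shows "tree_inversion_number s (Node y ts) c a = 0"
  using assms left_of_Node[of y ts a c] unfolding tree_inversion_number_def by auto

lemma tree_inversion_number_right:
  assumes d: "decreasing s (Node y ts)" and ij: "j < i" "i < length ts"
    and a: "a \<in> set (labels (ts ! i))" and c: "c \<in> set (labels (ts ! j))"
  shows "tree_inversion_number s (Node y ts) c a = part s c"
proof -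
  have j: "j < length ts" using ij by simp
  have "\<not> left_of (Node y ts) a c"
    unfolding left_of_Node using decreasing_NodeD(4)[OF d] a c ij left_of_labels
    by (metis less_asym less_irrefl less_trans)
  moreover have "\<not> belongs a (child (Node y ts) c k)" if "k \<le> part s c" for k
    unfolding children_child[OF d j c]
    using labels_child(1)[OF decreasing_NodeD(2)[OF d j] c that] decreasing_NodeD(4)[OF d ij(2) j a] ij
    by blast
  ultimately show ?thesis unfolding tree_inversion_number_def by auto
qed

lemma tree_inversion_number_le:
  "decreasing s T \<Longrightarrow> a \<in> set (labels T) \<Longrightarrow> c \<in> set (labels T) \<Longrightarrow> a < c \<Longrightarrow>
     tree_inversion_number s T c a \<le> part s c"
proof (induction T rule: ptree_induct_nth)
  case (Node y ts)
  note D = decreasing_NodeD[OF Node(2)]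
  have "a \<noteq> y" using Node(4,5) D(3) unfolding labels_Node_iff by fastforce
  then obtain i where i: "i < length ts" "a \<in> set (labels (ts ! i))"
    using Node(3) labels_Node_iff by blast
  show ?case
  proof (cases "c = y")
    case True
    then show ?thesis using tree_inversion_number_root[OF Node(2) i] i D(1) by simp
  next
    case False
    then obtain j where j: "j < length ts" "c \<in> set (labels (ts ! j))"
      using Node(4) labels_Node_iff by blast
    consider "i < j" | "j < i" | "i = j" by linarith
    then show ?thesis
    proof cases
      case 1
      then show ?thesis using tree_inversion_number_left i j by simp
    next
      case 2
      then show ?thesis using tree_inversion_number_right[OF Node(2)] i j by simp
    next
      case 3
      then show ?thesis
        using tree_inversion_number_child[OF Node(2) i(1)] Node(1)[OF i(1) D(2)] i j Node(5) by simp
    qed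
  qed
qed simp

lemma tree_inversion_number_trans_planar:
  "decreasing s T \<Longrightarrow> {a, b, c} \<subseteq> set (labels T) \<Longrightarrow> a < b \<Longrightarrow> b < c \<Longrightarrow>
     (tree_inversion_number s T b a = 0 \<or>
        tree_inversion_number s T c b \<le> tree_inversion_number s T c a) \<and>
     (tree_inversion_number s T b a = part s b \<or>
        tree_inversion_number s T c a \<le> tree_inversion_number s T c b)"
proof (induction T rule: ptree_induct_nth)
  case (Node y ts)
  note D = decreasing_NodeD[OF Node(2)]
  have "c \<le> y" using Node(3) labels_le_root[OF Node(2)] by blast
  then have "a \<noteq> y" "b \<noteq> y" using Node(4,5) by auto
  moreover have mem: "a \<in> set (labels (Node y ts))" "b \<in> set (labels (Node y ts))"
    "c \<in> set (labels (Node y ts))"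
    using Node(3) by blast+
  ultimately obtain i j where i: "i < length ts" "a \<in> set (labels (ts ! i))"
    and j: "j < length ts" "b \<in> set (labels (ts ! j))"
    using labels_Node_iff[of a y ts] labels_Node_iff[of b y ts] by blast
  note L = tree_inversion_number_left[of _ _ ts _ _ s y] and R = tree_inversion_number_right[OF Node(2)]
    and C = tree_inversion_number_child[OF Node(2)] and Rt = tree_inversion_number_root[OF Node(2)]
  show ?case
  proof (cases "c = y")
    case True
    have "tree_inversion_number s (Node y ts) c a = i" "tree_inversion_number s (Node y ts) c b = j"
      using True Rt i j by auto
    then show ?thesis using L[of i j a b] R[of j i a b] i j by (cases i j rule: linorder_cases) auto
  next
    case False
    then obtain k where k: "k < length ts" "c \<in> set (labels (ts ! k))"
      using mem(3) labels_Node_iff[of c y ts] by blast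
    have le: "tree_inversion_number s (Node y ts) c a \<le> part s c"
      "tree_inversion_number s (Node y ts) c b \<le> part s c"
      using tree_inversion_number_le[OF Node(2)] mem Node(4,5) less_trans by blast+
    show ?thesis
    proof (cases "i = j")
      case ij: True
      show ?thesis
      proof (cases "i = k")
        case True
        then show ?thesis
          using ij C[OF i(1)] i j k Node(1)[OF i(1) D(2)[OF i(1)]] Node(4,5) by simp
      next
        case False
        then have "tree_inversion_number s (Node y ts) c a = tree_inversion_number s (Node y ts) c b"
          using ij L[of i k a c] L[of j k b c] R[of k i a c] R[of k j b c] i j k
          by (cases i k rule: linorder_cases) auto
        then show ?thesis by simp
      qed
    next
      case False
      \<comment> \<open>If \<open>a\<close> is left of \<open>b\<close>, only planarity is at stake:
        either \<open>b\<close> is right of \<open>c\<close> and has the maximal number there, or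
        \<open>a\<close> is left of \<open>c\<close> and has number \<open>0\<close>. The other side
        is symmetric, with transitivity at stake.\<close>
      have "tree_inversion_number s (Node y ts) b a = 0 \<and>
          (k < j \<or> tree_inversion_number s (Node y ts) c a = 0) \<or>
        tree_inversion_number s (Node y ts) b a = part s b \<and>
          (j < k \<or> tree_inversion_number s (Node y ts) c a = part s c)"
      proof (cases "i < j")
        case True
        then show ?thesis using L[OF True j(1) i(2) j(2)] L[of i k a c] i k by (cases "k < j") auto
      next
        case F: False
        then have "j < i" using False by simp
        then show ?thesis using R[of j i a b] R[of k i a c] i j k by (cases "j < k") auto
      qed
      then show ?thesis
        using le R[of k j b c] L[of j k b c] j k by auto
    qed
  qed
qed simp

section \<open>Descendants, and trees determined by their inversion numbers\<close>

lemma belongs_child: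
  "decreasing s T \<Longrightarrow> c \<in> set (labels T) \<Longrightarrow> k \<le> part s c \<Longrightarrow> belongs a (child T c k) \<Longrightarrow>
     tree_inversion_number s T c a = k"
proof (induction T rule: ptree_induct_nth)
  case (Node y ts)
  note D = decreasing_NodeD[OF Node(2)]
  show ?case
  proof (cases "c = y")
    case True
    then show ?thesis
      using tree_inversion_number_root[OF Node(2), of k a] Node(4,5) D(1) children_root[OF Node(2)]
      by simp
  next
    case False
    then obtain j where j: "j < length ts" "c \<in> set (labels (ts ! j))"
      using Node(3) labels_Node_iff by blast
    have b: "belongs a (child (ts ! j) c k)" using Node(5) children_child[OF Node(2) j] by simp
    then have "a \<in> set (labels (ts ! j))" using labels_child(1)[OF D(2)] j Node(4) by blast
    then show ?thesis
      using Node(1)[OF j(1) D(2) j(2) Node(4) b] tree_inversion_number_child[OF Node(2)] j by simp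
  qed
qed simp

text \<open>If \<open>a\<close> and \<open>c\<close> lie in different children of the root, the root
  tells them apart. If they share a child, neither the root nor a node of another child can.\<close>

lemma descendant_iff:
  "decreasing s T \<Longrightarrow> a \<in> set (labels T) \<Longrightarrow> c \<in> set (labels T) \<Longrightarrow> a < c \<Longrightarrow>
     descendant s T a c \<longleftrightarrow>
       (\<forall>y \<in> set (labels T). c < y \<longrightarrow> tree_inversion_number s T y a = tree_inversion_number s T y c)"
proof (induction T rule: ptree_induct_nth)
  case (Node y ts)
  note D = decreasing_NodeD[OF Node(2)]
  note le = labels_le_root[OF Node(2)]
  then have "a \<noteq> y" using Node(4,5) by fastforce
  then obtain i where i: "i < length ts" "a \<in> set (labels (ts ! i))"
    using Node(3) labels_Node_iff by blast
  show ?case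
  proof (cases "c = y")
    case True
    then have "descendant s (Node y ts) a c"
      using children_root[OF Node(2)] i D(1) Node(4) unfolding descendant_def
      by (auto intro!: exI[of _ i])
    then show ?thesis using True le by fastforce
  next
    case False
    then obtain j where j: "j < length ts" "c \<in> set (labels (ts ! j))"
      using Node(4) labels_Node_iff by blast
    note root = tree_inversion_number_root[OF Node(2)]
    have desc: "descendant s (Node y ts) a c \<longleftrightarrow> descendant s (ts ! j) a c"
      unfolding descendant_def using children_child[OF Node(2) j] Node(4) j by simp
    show ?thesis
    proof (cases "i = j")
      case True
      have "tree_inversion_number s (Node y ts) z a = tree_inversion_number s (Node y ts) z c \<longleftrightarrow>
          (z \<in> set (labels (ts ! j)) \<longrightarrow>
             tree_inversion_number s (ts ! j) z a = tree_inversion_number s (ts ! j) z c)"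
        if z: "z \<in> set (labels (Node y ts))" "c < z" for z
      proof (cases "z = y")
        case z: True
        then have "z \<notin> set (labels (ts ! j))" using D(3) j by blast
        then show ?thesis using root[OF i] root[OF j] True z by simp
      next
        case False
        then obtain k where k: "k < length ts" "z \<in> set (labels (ts ! k))"
          using z labels_Node_iff by blast
        show ?thesis
        proof (cases "k = j")
          case kj: True
          then show ?thesis
            using tree_inversion_number_child[OF Node(2) j(1)] True i j k by simp
        next
          case False
          then have "z \<notin> set (labels (ts ! j))" using D(4) j k by blast
          moreover have
            "tree_inversion_number s (Node y ts) z a = tree_inversion_number s (Node y ts) z c"
            using False True i j k tree_inversion_number_left[of j k ts a z s y]
              tree_inversion_number_left[of j k ts c z s y]
              tree_inversion_number_right[OF Node(2), of k j a z]
              tree_inversion_number_right[OF Node(2), of k j c z]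
            by (cases j k rule: linorder_cases) auto
          ultimately show ?thesis by simp
        qed
      qed
      then have "(\<forall>z \<in> set (labels (Node y ts)). c < z \<longrightarrow>
            tree_inversion_number s (Node y ts) z a = tree_inversion_number s (Node y ts) z c) \<longleftrightarrow>
          (\<forall>z \<in> set (labels (ts ! j)). c < z \<longrightarrow>
            tree_inversion_number s (ts ! j) z a = tree_inversion_number s (ts ! j) z c)"
        using j(1) labels_Node_iff by blast
      then show ?thesis using Node(1)[OF j(1) D(2)[OF j(1)]] desc True i j Node(5) by simp
    next
      case False
      have "\<not> descendant s (ts ! j) a c"
        unfolding descendant_def
        using labels_child(1)[OF D(2)[OF j(1)] j(2)] D(4)[OF i(1) j(1) i(2)] False by blast
      moreover have "c < y" using D(3) j by blast
      moreover have "tree_inversion_number s (Node y ts) y a \<noteq> tree_inversion_number s (Node y ts) y c"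
        using root[OF i] root[OF j] False by simp
      ultimately show ?thesis using desc labels_Node_iff by blast
    qed
  qed
qed simp

text \<open>The root is the largest label, and its inversion numbers tell which child contains each
  label.\<close>

lemma decreasing_eqI:
  "decreasing s T \<Longrightarrow> decreasing s T' \<Longrightarrow> set (labels T) = set (labels T') \<Longrightarrow>
     (\<And>a c. a \<in> set (labels T) \<Longrightarrow> c \<in> set (labels T) \<Longrightarrow> a < c \<Longrightarrow>
        tree_inversion_number s T c a = tree_inversion_number s T' c a) \<Longrightarrow> T = T'"
proof (induction T arbitrary: T' rule: ptree_induct_nth)
  case Leaf
  then show ?case by (cases T') auto
next
  case (Node y ts)
  obtain y' ts' where T': "T' = Node y' ts'" using Node(4) by (cases T') auto
  note D = decreasing_NodeD[OF Node(2)] and D' = decreasing_NodeD[OF Node(3)[unfolded T']]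
  have y: "y' = y"
    using Node(4) D(3) D'(3) unfolding T' by (metis labels_Node_iff less_asym)
  have root: "tree_inversion_number s (Node y ts) y a = i" if "i < length ts" "belongs a (ts ! i)" for a i
    using tree_inversion_number_root[OF Node(2)] that by blast
  have root': "tree_inversion_number s (Node y ts') y a = i" if "i < length ts'" "belongs a (ts' ! i)" for a i
    using tree_inversion_number_root[OF Node(3)[unfolded T']] that y by blast
  have len: "length ts' = length ts" using D(1) D'(1) y by simp
  have "ts ! i = ts' ! i" if i: "i < length ts" for i
  proof (rule Node(1)[OF i D(2)[OF i]])
    show "decreasing s (ts' ! i)" using D'(2) i len by simp
    show lab: "set (labels (ts ! i)) = set (labels (ts' ! i))"
    proof (intro set_eqI iffI)
      fix a assume a: "a \<in> set (labels (ts ! i))"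
      then have "a < y" using D(3) i by blast
      moreover have L: "a \<in> set (labels (Node y ts))" using a i labels_Node_iff by blast
      ultimately obtain j where j: "j < length ts'" "a \<in> set (labels (ts' ! j))"
        using Node(4) unfolding T' y by (metis labels_Node_iff less_irrefl)
      have "y \<in> set (labels (Node y ts))" by simp
      then have "j = i"
        using root[OF i a] root'[OF j] Node(5)[OF L _ \<open>a < y\<close>] unfolding T' y by simp
      then show "a \<in> set (labels (ts' ! i))" using j by simp
    next
      fix a assume a: "a \<in> set (labels (ts' ! i))"
      have i': "i < length ts'" using i len by simp
      then have "a < y" using D'(3) a y by blast
      moreover have L: "a \<in> set (labels (Node y ts))"
        using a i' Node(4) labels_Node_iff unfolding T' y by blast
      ultimately obtain j where j: "j < length ts" "a \<in> set (labels (ts ! j))"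
        by (metis labels_Node_iff less_irrefl)
      have "y \<in> set (labels (Node y ts))" by simp
      then have "j = i"
        using root[OF j] root'[OF i' a] Node(5)[OF L _ \<open>a < y\<close>] unfolding T' y by simp
      then show "a \<in> set (labels (ts ! i))" using j by simp
    qed
    fix a c assume ac: "a \<in> set (labels (ts ! i))" "c \<in> set (labels (ts ! i))" "a < c"
    then have "a \<in> set (labels (Node y ts))" "c \<in> set (labels (Node y ts))"
      using i labels_Node_iff by blast+
    then show "tree_inversion_number s (ts ! i) c a = tree_inversion_number s (ts' ! i) c a"
      using Node(5)[OF _ _ ac(3)] tree_inversion_number_child[OF Node(2) i ac(1,2)]
        tree_inversion_number_child[OF Node(3)[unfolded T'], of i a c] ac lab i len
      unfolding T' y by simp
  qed
  then show ?case unfolding T' y using len by (simp add: nth_equalityI)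
qed

text \<open>The largest label \<open>y\<close> becomes the root, and child \<open>i\<close> receives
  the labels \<open>a\<close> with \<open>x y a = i\<close>. For labels in different children,
  transitivity and planarity with respect to \<open>y\<close> force \<open>x\<close> to have the
  extreme value that the tree assigns.\<close>

lemma decreasing_exists:
  assumes "finite S"
    and le: "\<And>c a. x c a \<le> part s c"
    and trans: "\<And>a b c. a < b \<Longrightarrow> b < c \<Longrightarrow> x b a = 0 \<or> x c b \<le> x c a"
    and planar: "\<And>a b c. a < b \<Longrightarrow> b < c \<Longrightarrow> x b a = part s b \<or> x c a \<le> x c b"
  shows "\<exists>T. decreasing s T \<and> set (labels T) = S \<and>
    (\<forall>a \<in> S. \<forall>c \<in> S. a < c \<longrightarrow> tree_inversion_number s T c a = x c a)"
  using assms(1)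
proof (induction S rule: finite_psubset_induct)
  case (psubset S)
  show ?case
  proof (cases "S = {}")
    case True
    then show ?thesis by (intro exI[of _ Leaf]) auto
  next
    case False
    define y where "y = Max S"
    have y: "y \<in> S" "\<And>a. a \<in> S \<Longrightarrow> a \<le> y" using psubset(1) False by (auto simp: y_def)
    define part_of where "part_of i = {a \<in> S. a < y \<and> x y a = i}" for i
    have "part_of i \<subset> S" for i using y unfolding part_of_def by blast
    then have "\<forall>i. \<exists>T. decreasing s T \<and> set (labels T) = part_of i \<and>
        (\<forall>a \<in> part_of i. \<forall>c \<in> part_of i. a < c \<longrightarrow> tree_inversion_number s T c a = x c a)"
      using psubset(2) by blast
    then obtain f where f: "\<And>i. decreasing s (f i)" "\<And>i. set (labels (f i)) = part_of i"
      "\<And>i a c. a \<in> part_of i \<Longrightarrow> c \<in> part_of i \<Longrightarrow> a < c \<Longrightarrow>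
         tree_inversion_number s (f i) c a = x c a"
      by metis
    define ts where "ts = map f [0..<part s y + 1]"
    have len: "length ts = part s y + 1" and nth: "\<And>i. i \<le> part s y \<Longrightarrow> ts ! i = f i"
      unfolding ts_def by (auto simp del: upt_Suc)
    have dec: "decreasing s (Node y ts)"
      unfolding decreasing_Node len using nth f(1,2) by (auto simp: part_of_def less_Suc_eq_le)
    have mem: "a \<in> set (labels (ts ! x y a)) \<and> x y a < length ts" if "a \<in> S" "a < y" for a
      using that nth[OF le] f(2) le len by (simp add: part_of_def less_Suc_eq_le)
    have "a \<in> set (labels (Node y ts)) \<longleftrightarrow> a \<in> S" for a
    proof
      assume "a \<in> S" then show "a \<in> set (labels (Node y ts))"
        unfolding labels_Node_iff using mem y(2) le_neq_implies_less by blast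
    next
      assume "a \<in> set (labels (Node y ts))" then show "a \<in> S"
        unfolding labels_Node_iff using y(1) nth f(2) len
        by (auto simp: part_of_def less_Suc_eq_le)
    qed
    moreover have "tree_inversion_number s (Node y ts) c a = x c a"
      if ac: "a \<in> S" "c \<in> S" "a < c" for a c
    proof -
      have a: "a < y" using ac y(2) by fastforce
      note ma = mem[OF ac(1) a]
      show ?thesis
      proof (cases "c = y")
        case True
        then show ?thesis using tree_inversion_number_root[OF dec] ma by blast
      next
        case False
        then have c: "c < y" using ac y(2) le_neq_implies_less by blast
        note mc = mem[OF ac(2) c]
        consider "x y a < x y c" | "x y c < x y a" | "x y a = x y c" by linarith
        then show ?thesis
        proof cases
          case 1
          then show ?thesis
            using tree_inversion_number_left[OF 1] ma mc trans[OF ac(3) c] by simp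
        next
          case 2
          then show ?thesis
            using tree_inversion_number_right[OF dec 2] ma mc planar[OF ac(3) c] by simp
        next
          case 3
          then show ?thesis
            using tree_inversion_number_child[OF dec, of "x y a" a c] ma mc
              f(3)[of a "x y a" c] ac a c nth[OF le] by (simp add: part_of_def)
        qed
      qed
    qed
    ultimately show ?thesis using dec by blast
  qed
qed

section \<open>Pure intervals\<close>

text \<open>Unlike \<^const>\<open>tree_inversion_number\<close>, this is \<open>0\<close> outside the index pairs.\<close>

definition inversion_count :: "weak_composition \<Rightarrow> ptree \<Rightarrow> nat \<Rightarrow> nat \<Rightarrow> nat" where
  "inversion_count s T c a = count (tree_inversions s T) (c, a)"

lemma inversion_count_eq:
  "inversion_count s T c a =
     (if (c, a) \<in> index_pairs (length s) then tree_inversion_number s T c a else 0)"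
  by (simp add: inversion_count_def count_tree_inversions)

lemma index_pairs_iff_labels:
  "s_decreasing_tree s T \<Longrightarrow>
     (c, a) \<in> index_pairs (length s) \<longleftrightarrow> a \<in> set (labels T) \<and> c \<in> set (labels T) \<and> a < c"
  by (auto simp: s_decreasing_tree_iff index_pairs_def)

lemma s_weak_le_iff:
  "s_weak_le s R T \<longleftrightarrow> (\<forall>c a. inversion_count s R c a \<le> inversion_count s T c a)"
  by (auto simp: s_weak_le_def inversion_count_eq)

lemma multi_inversion_inversion_count:
  assumes T: "s_decreasing_tree s T"
  shows "multi_inversion (length s) (part s) (inversion_count s T)"
  unfolding multi_inversion_def
proof (intro conjI allI impI)
  note d = T[unfolded s_decreasing_tree_iff, THEN conjunct1]
  note ip = index_pairs_iff_labels[OF T]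
  fix c a
  show "inversion_count s T c a = 0" if "(c, a) \<notin> index_pairs (length s)"
    using that by (simp add: inversion_count_eq)
  show "inversion_count s T c a \<le> part s c"
    using tree_inversion_number_le[OF d] by (simp add: inversion_count_eq ip)
  fix b assume h: "a < b \<and> b < c"
  have "(inversion_count s T b a = 0 \<or> inversion_count s T c b \<le> inversion_count s T c a) \<and>
    (inversion_count s T b a = part s b \<or> inversion_count s T c a \<le> inversion_count s T c b)"
  proof (cases "{a, b, c} \<subseteq> set (labels T)")
    case True
    then show ?thesis
      using tree_inversion_number_trans_planar[OF d True] h by (simp add: inversion_count_eq ip)
  next
    case False
    have "a \<in> set (labels T) \<and> c \<in> set (labels T) \<longrightarrow> b \<in> set (labels T)"
      using T h by (auto simp: s_decreasing_tree_iff)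
    then have "inversion_count s T c a = 0" using False by (auto simp: inversion_count_eq ip)
    moreover have "inversion_count s T c b = 0 \<or> inversion_count s T b a = 0"
      using False by (auto simp: inversion_count_eq ip)
    ultimately show ?thesis by auto
  qed
  then show "inversion_count s T b a = 0 \<or> inversion_count s T c b \<le> inversion_count s T c a"
    "inversion_count s T b a = part s b \<or> inversion_count s T c a \<le> inversion_count s T c b"
    by auto
qed

lemma s_decreasing_tree_exists:
  assumes "multi_inversion (length s) (part s) x"
  obtains T where "s_decreasing_tree s T" "inversion_count s T = x"
proof -
  obtain T where T: "decreasing s T" "set (labels T) = {1..length s}"
    "\<forall>a \<in> {1..length s}. \<forall>c \<in> {1..length s}. a < c \<longrightarrow> tree_inversion_number s T c a = x c a"
    using decreasing_exists[of "{1..length s}" x s] assms unfolding multi_inversion_def by auto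
  then have "s_decreasing_tree s T" by (simp add: s_decreasing_tree_iff)
  moreover have "inversion_count s T = x"
    using T(3) multi_inversion_outside[OF assms]
    by (intro ext) (auto simp: inversion_count_eq index_pairs_def)
  ultimately show ?thesis using that by blast
qed

lemma s_decreasing_tree_eqI:
  assumes "s_decreasing_tree s T" "s_decreasing_tree s T'"
    and "inversion_count s T = inversion_count s T'"
  shows "T = T'"
proof (rule decreasing_eqI)
  show "decreasing s T" "decreasing s T'" "set (labels T) = set (labels T')"
    using assms by (auto simp: s_decreasing_tree_iff)
  fix a c assume "a \<in> set (labels T)" "c \<in> set (labels T)" "a < c"
  then have "(c, a) \<in> index_pairs (length s)" using index_pairs_iff_labels[OF assms(1)] by blast
  then show "tree_inversion_number s T c a = tree_inversion_number s T' c a"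
    using fun_cong[OF fun_cong[OF assms(3)], of c a] by (simp add: inversion_count_eq)
qed

section \<open>Tree-ascents in terms of inversion numbers\<close>

lemma descendant_iff_below:
  assumes T: "s_decreasing_tree s T" and ip: "(c, a) \<in> index_pairs (length s)"
  shows "descendant s T a c \<longleftrightarrow> below (inversion_count s T) a c"
proof -
  have d: "decreasing s T" "a \<in> set (labels T)" "c \<in> set (labels T)" "a < c"
    using T ip index_pairs_iff_labels[OF T] by (auto simp: s_decreasing_tree_iff)
  have "inversion_count s T y a = inversion_count s T y c \<longleftrightarrow>
      (y \<in> set (labels T) \<longrightarrow> tree_inversion_number s T y a = tree_inversion_number s T y c)"
    if "c < y" for y
    using that d index_pairs_iff_labels[OF T] by (auto simp: inversion_count_eq)
  then show ?thesis using descendant_iff[OF d] d(4) unfolding below_def by blast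
qed

lemma belongs_right_child_iff:
  assumes T: "s_decreasing_tree s T" and ip: "(c, a) \<in> index_pairs (length s)"
  shows "belongs a (child T c (part s c)) \<longleftrightarrow>
    descendant s T a c \<and> inversion_count s T c a = part s c"
proof -
  have d: "decreasing s T" "c \<in> set (labels T)"
    using T ip index_pairs_iff_labels[OF T] by (auto simp: s_decreasing_tree_iff)
  show ?thesis
    using belongs_child[OF d] d(2) ip unfolding descendant_def inversion_count_eq
    by (metis order_refl)
qed

lemma right_child_Leaf_iff:
  assumes T: "s_decreasing_tree s T" and a: "a \<in> set (labels T)"
  shows "child T a (part s a) = Leaf \<longleftrightarrow>
    (\<forall>e. (a, e) \<in> index_pairs (length s) \<longrightarrow> \<not> belongs e (child T a (part s a)))"
proof -
  have "t = Leaf \<longleftrightarrow> (\<forall>e. \<not> belongs e t)" for t by (cases t) auto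
  moreover have "(a, e) \<in> index_pairs (length s)" if "belongs e (child T a (part s a))" for e
    using labels_child[OF _ a order_refl that] T a index_pairs_iff_labels[OF T]
    unfolding s_decreasing_tree_iff by blast
  ultimately show ?thesis by blast
qed

lemma tree_ascents_iff:
  assumes T: "s_decreasing_tree s T"
  shows "(a, c) \<in> tree_ascents s T \<longleftrightarrow> ascent (length s) (part s) (inversion_count s T) a c"
proof (cases "(c, a) \<in> index_pairs (length s)")
  case ip: True
  let ?x = "inversion_count s T"
  have a: "a \<in> set (labels T)" "a < c" using ip index_pairs_iff_labels[OF T] by auto
  have le: "?x b e \<le> part s b" for b e
    using multi_inversion_le[OF multi_inversion_inversion_count[OF T]] .
  have ipb: "(b, a) \<in> index_pairs (length s)" if "a < b" "b < c" for b
    using that ip by (auto simp: index_pairs_def)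
  have "(\<forall>b. a < b \<and> b < c \<and> descendant s T a b \<longrightarrow> belongs a (child T b (part s b))) \<longleftrightarrow>
      (\<forall>b. b < c \<and> below ?x a b \<longrightarrow> ?x b a = part s b)"
    using descendant_iff_below[OF T ipb] belongs_right_child_iff[OF T ipb]
    unfolding below_def by blast
  moreover have "child T a (part s a) = Leaf \<longleftrightarrow> (\<forall>e. below ?x e a \<longrightarrow> ?x a e < part s a)"
    if "0 < part s a"
  proof -
    have "\<not> belongs e (child T a (part s a)) \<longleftrightarrow> (below ?x e a \<longrightarrow> ?x a e < part s a)"
      if "(a, e) \<in> index_pairs (length s)" for e
      using belongs_right_child_iff[OF T that] descendant_iff_below[OF T that] le[of a e] by auto
    moreover have "?x a e < part s a" if "(a, e) \<notin> index_pairs (length s)" for e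
      using that \<open>0 < part s a\<close> by (simp add: inversion_count_eq)
    ultimately show ?thesis unfolding right_child_Leaf_iff[OF T a(1)] by blast
  qed
  ultimately show ?thesis
    using belongs_right_child_iff[OF T ip] descendant_iff_below[OF T ip] ip a(2) le[of c a]
    unfolding tree_ascents_def ascent_def by auto
next
  case False
  have "\<not> (a < c \<and> descendant s T a c)"
    using False labels_child(1)[of s T c _ a] T index_pairs_iff_labels[OF T]
    unfolding descendant_def s_decreasing_tree_iff by blast
  then show ?thesis using False by (auto simp: tree_ascents_def ascent_def)
qed

text \<open>\<open>tc_number_pure_pair\<close> identifies the closure in the definite description
  with the inversions of \<open>U\<close>, and inversions determine the tree.\<close>

lemma tree_plus_eq:
  assumes T: "s_decreasing_tree s T" and U: "s_decreasing_tree s U"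
    and P: "pure_pair (length s) (part s) (inversion_count s T) (inversion_count s U)"
    and A: "\<And>a c. (a, c) \<in> A \<longleftrightarrow> (a, c) \<in> tree_ascents s T \<and>
      inversion_count s T c a < inversion_count s U c a"
  shows "tree_plus s T A = U"
proof -
  define I where "I = tree_inversions s T + mset_set (prod.swap ` A)"
  have "prod.swap ` A \<subseteq> index_pairs (length s)"
    using A tree_ascents_iff[OF T] by (auto simp: ascent_def)
  then have "finite (prod.swap ` A)" by (rule finite_subset) simp
  moreover have "(c, a) \<in> prod.swap ` A \<longleftrightarrow> (a, c) \<in> A" for a c by force
  ultimately have "count I (c, a) = inversion_count s T c a +
      of_bool (ascent (length s) (part s) (inversion_count s T) a c \<and>
        inversion_count s T c a < inversion_count s U c a)" for c a
    using A[of a c] tree_ascents_iff[OF T, of a c] by (simp add: I_def inversion_count_def)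
  then have "tc_number I c a = inversion_count s U c a" if "(c, a) \<in> index_pairs (length s)" for c a
    using tc_number_pure_pair[OF P] that by (auto simp: index_pairs_def)
  then have "count (transitive_closure (length s) I) (c, a) = count (tree_inversions s U) (c, a)"
    for c a
    by (simp add: count_transitive_closure inversion_count_def count_tree_inversions)
  then have eq: "tree_inversions s U = transitive_closure (length s) I"
    by (simp add: multiset_eq_iff split_paired_all)
  show ?thesis
    unfolding tree_plus_def I_def[symmetric] eq[symmetric]
  proof (rule the_equality)
    fix R assume "s_decreasing_tree s R \<and> tree_inversions s R = tree_inversions s U"
    then show "R = U" using s_decreasing_tree_eqI[of s R U] U by (simp add: inversion_count_def fun_eq_iff)
  qed (use U in simp)
qed

text \<open>From \<open>A\<close>, the upper end is the tree realizing \<open>raised\<close>.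
  Conversely, \<open>A\<close> consists of the ascents of \<open>T\<close> whose number varies.
  \<open>tree_plus_eq\<close> wants this form of \<open>A\<close> in both directions;
  \<open>A_iff\<close> provides it in the first.\<close>

lemma pure_interval_iff:
  "pure_interval s I \<longleftrightarrow> (\<exists>T U. s_decreasing_tree s T \<and> s_decreasing_tree s U \<and>
     pure_pair (length s) (part s) (inversion_count s T) (inversion_count s U) \<and>
     I = s_weak_interval s T U)"
proof
  assume "pure_interval s I"
  then obtain T A where T: "s_decreasing_tree s T" and A: "A \<subseteq> tree_ascents s T"
    and I: "I = s_weak_interval s T (tree_plus s T A)"
    unfolding pure_interval_def by blast
  interpret ascent_set "length s" "part s" "inversion_count s T" "\<lambda>a c. (a, c) \<in> A"
    using multi_inversion_inversion_count[OF T] A tree_ascents_iff[OF T]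
    by unfold_locales auto
  obtain U where U: "s_decreasing_tree s U" "inversion_count s U = raised"
    using s_decreasing_tree_exists[OF multi_inversion_raised] by blast
  have P: "pure_pair (length s) (part s) (inversion_count s T) (inversion_count s U)"
    using pure_pair_raised U by simp
  have "tree_plus s T A = U"
  proof (rule tree_plus_eq[OF T U(1) P])
    fix a c
    show "(a, c) \<in> A \<longleftrightarrow> (a, c) \<in> tree_ascents s T \<and> inversion_count s T c a < inversion_count s U c a"
      unfolding U(2) tree_ascents_iff[OF T] by (rule A_iff)
  qed
  then show "\<exists>T U. s_decreasing_tree s T \<and> s_decreasing_tree s U \<and>
     pure_pair (length s) (part s) (inversion_count s T) (inversion_count s U) \<and>
     I = s_weak_interval s T U"
    using T U(1) P I by blast
next
  assume "\<exists>T U. s_decreasing_tree s T \<and> s_decreasing_tree s U \<and>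
     pure_pair (length s) (part s) (inversion_count s T) (inversion_count s U) \<and>
     I = s_weak_interval s T U"
  then obtain T U where T: "s_decreasing_tree s T" and U: "s_decreasing_tree s U"
    and P: "pure_pair (length s) (part s) (inversion_count s T) (inversion_count s U)"
    and I: "I = s_weak_interval s T U" by blast
  define A where "A = {(a, c) \<in> tree_ascents s T. inversion_count s T c a < inversion_count s U c a}"
  have "tree_plus s T A = U" by (rule tree_plus_eq[OF T U P]) (simp add: A_def)
  moreover have "A \<subseteq> tree_ascents s T" by (auto simp: A_def)
  ultimately show "pure_interval s I" unfolding pure_interval_def using T I by metis
qed

lemma pure_interval_Int:
  assumes "pure_interval s I" "pure_interval s J" "I \<inter> J \<noteq> {}"
  shows "pure_interval s (I \<inter> J)"
proof -
  let ?x = "inversion_count s"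
  obtain T U where P: "pure_pair (length s) (part s) (?x T) (?x U)" and I: "I = s_weak_interval s T U"
    using assms(1) pure_interval_iff by blast
  obtain T' U' where P': "pure_pair (length s) (part s) (?x T') (?x U')"
    and J: "J = s_weak_interval s T' U'"
    using assms(2) pure_interval_iff by blast
  define l where "l c a = max (?x T c a) (?x T' c a)" for c a
  define u where "u c a = min (?x U c a) (?x U' c a)" for c a
  \<comment> \<open>A common tree keeps both lower ends below both upper ends, which is the
    consistency required by \<open>pure_pair_min_max\<close>.\<close>
  obtain R where "R \<in> I" "R \<in> J" using assms(3) by blast
  then have R: "?x T c a \<le> ?x R c a" "?x R c a \<le> ?x U c a" "?x T' c a \<le> ?x R c a"
    "?x R c a \<le> ?x U' c a" for c a
    unfolding I J s_weak_interval_def s_weak_le_iff by auto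
  have "max (?x T c a) (?x T' c a) \<le> min (?x U c a) (?x U' c a)" for c a
    using R[of c a] by linarith
  from pure_pair_min_max[OF P P' this] have lu: "pure_pair (length s) (part s) l u"
    by (simp add: l_def[abs_def] u_def[abs_def])
  obtain B where B: "s_decreasing_tree s B" "?x B = l"
    using s_decreasing_tree_exists[OF pure_pairD(1)[OF lu]] by blast
  obtain C where C: "s_decreasing_tree s C" "?x C = u"
    using s_decreasing_tree_exists[OF pure_pairD(2)[OF lu]] by blast
  have "I \<inter> J = s_weak_interval s B C"
    unfolding I J s_weak_interval_def s_weak_le_iff B(2) C(2) l_def u_def by auto
  then show ?thesis unfolding pure_interval_iff using B C lu by blast
qed

theorem theorem2p6:
  fixes s :: weak_composition
  shows "(\<forall>I \<in> Perm s. \<forall>J. J \<subseteq> I \<and> pure_interval s J \<longrightarrow> J \<in> Perm s) \<and>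
         (\<forall>I \<in> Perm s. \<forall>J \<in> Perm s. I \<inter> J \<noteq> {} \<longrightarrow> I \<inter> J \<in> Perm s)"
  using pure_interval_Int by (auto simp: Perm_def)

end
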